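(* Let $\Omega\subset\mathbb{R}^n$ be a bounded open set, let $t>0$, $\gamma<n$, and let $\rho\in L^\infty(\Omega)$ be a non-negative weight such that for some constant $K>0$ $$\int_\Omega\frac{1}{\rho(y)^t\,|x-y|^{\gamma}}\,dy\le K\qquad\text{for every }x\in\Omega .$$ Let $q$ satisfy (i) $q>\frac{n-\gamma}{t}$, (ii) $q>1+\frac1t$, (iii) $q<\frac{n-\gamma}{t}+n$, and define $q^*$ by $$\frac{1}{q^*}=\frac1q\Big(1+\frac1t-\frac{\gamma}{nt}\Big)-\frac1n .$$ Then there exists a constant $c=c(n,q,\rho,t,\gamma,K)>0$ such that $$\|u\|_{L^{q^*}(\Omega)}\le c\,\Big(\int_\Omega|Du|^q\rho\,dx\Big)^{1/q}$$ for every $u\in C^1_c(\Omega)$, and hence (by density) for every $u\in W^{1,q}_0(\Omega,\rho)$.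
   Context: $W^{1,q}_0(\Omega,\rho)$ denotes the weighted Sobolev space obtained as the closure of $C^1_c(\Omega)$ with respect to the norm $\|u\|_{L^q(\Omega)}+\|Du\|_{L^q(\Omega,\rho)}$, where $\|Du\|_{L^q(\Omega,\rho)}=(\int_\Omega|Du|^q\rho\,dx)^{1/q}$. *)

theory Defs
  imports "HOL-Analysis.Analysis"
begin

definition C1c_with_grad :: "'a::euclidean_space set \<Rightarrow> ('a \<Rightarrow> real) \<Rightarrow> ('a \<Rightarrow> 'a) \<Rightarrow> bool" where
  "C1c_with_grad \<Omega> u Du \<longleftrightarrow>
     (\<forall>x. (u has_derivative (\<lambda>h. Du x \<bullet> h)) (at x)) \<and> continuous_on UNIV Du \<and>
     compact (closure {x. u x \<noteq> 0}) \<and> closure {x. u x \<noteq> 0} \<subseteq> \<Omega>"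

text \<open>Weighted Sobolev space W^{1,q}_0(Omega,rho), as the completion (closure) of
  C^1_c(Omega) w.r.t. the norm ||u||_{L^q} + ||Du||_{L^q(rho)}: an element is a pair
  (u, G) with u in L^q(Omega), G in L^q(Omega,rho) (vector valued), which is the limit
  of some sequence (phi_k, D phi_k) with phi_k in C^1_c(Omega).\<close>
definition W10 :: "'a::euclidean_space set \<Rightarrow> ('a \<Rightarrow> real) \<Rightarrow> real \<Rightarrow> (('a \<Rightarrow> real) \<times> ('a \<Rightarrow> 'a)) set" where
  "W10 \<Omega> \<rho> q = {(u, G).
     u \<in> borel_measurable (lebesgue_on \<Omega>) \<and> G \<in> borel_measurable (lebesgue_on \<Omega>) \<and>
     (\<integral>\<^sup>+ x\<in>\<Omega>. ennreal (\<bar>u x\<bar> powr q) \<partial>lebesgue) < \<infinity> \<and>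
     (\<integral>\<^sup>+ x\<in>\<Omega>. ennreal (norm (G x) powr q * \<rho> x) \<partial>lebesgue) < \<infinity> \<and>
     (\<exists>\<phi> D\<phi>. (\<forall>k. C1c_with_grad \<Omega> (\<phi> k) (D\<phi> k)) \<and>
        ((\<lambda>k. \<integral>\<^sup>+ x\<in>\<Omega>. ennreal (\<bar>\<phi> k x - u x\<bar> powr q) \<partial>lebesgue) \<longlongrightarrow> 0) sequentially \<and>
        ((\<lambda>k. \<integral>\<^sup>+ x\<in>\<Omega>. ennreal (norm (D\<phi> k x - G x) powr q * \<rho> x) \<partial>lebesgue) \<longlongrightarrow> 0) sequentially)}"

definition kernel_integrand :: "('a::euclidean_space \<Rightarrow> real) \<Rightarrow> real \<Rightarrow> real \<Rightarrow> 'a \<Rightarrow> 'a \<Rightarrow> ennreal" where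
  "kernel_integrand \<rho> t \<gamma> x y =
     (if \<rho> y = 0 then \<infinity> else ennreal (1 / (\<rho> y powr t * norm (x - y) powr \<gamma>)))"

text \<open>Real-valued L^p quantities (used only when the underlying integral is finite).\<close>
definition Lp_int :: "real \<Rightarrow> 'a::euclidean_space set \<Rightarrow> ('a \<Rightarrow> real) \<Rightarrow> ennreal" where
  "Lp_int p A f = (\<integral>\<^sup>+ x\<in>A. ennreal (\<bar>f x\<bar> powr p) \<partial>lebesgue)"

definition Lp_norm :: "real \<Rightarrow> 'a::euclidean_space set \<Rightarrow> ('a \<Rightarrow> real) \<Rightarrow> real" where
  "Lp_norm p A f = enn2real (Lp_int p A f) powr (1 / p)"

definition wgrad_int :: "real \<Rightarrow> ('a::euclidean_space \<Rightarrow> real) \<Rightarrow> 'a set \<Rightarrow> ('a \<Rightarrow> 'a) \<Rightarrow> ennreal" where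
  "wgrad_int q \<rho> A G = (\<integral>\<^sup>+ x\<in>A. ennreal (norm (G x) powr q * \<rho> x) \<partial>lebesgue)"

definition wgrad_norm :: "real \<Rightarrow> ('a::euclidean_space \<Rightarrow> real) \<Rightarrow> 'a set \<Rightarrow> ('a \<Rightarrow> 'a) \<Rightarrow> real" where
  "wgrad_norm q \<rho> A G = enn2real (wgrad_int q \<rho> A G) powr (1 / q)"

end

theory Submission
  imports Defs
begin

text \<open>Write \<open>n\<close> for the dimension and \<open>q*\<close> for \<open>qs\<close>.
  For \<open>E = {|v| \<ge> 1}\<close>, the fundamental theorem of calculus along the rays \<open>x + s z\<close>,
  averaged over \<open>x \<in> E\<close> and over \<open>z\<close> in a fixed ball \<open>D\<close> of directions, bounds \<open>|E|\<close> by the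
  integral over \<open>s\<close> of the slices \<open>\<integral>\<integral> |Dv (x + s z)| dz dx\<close>. On a slice, Hoelder's inequality
  with the three exponents \<open>1/q\<close> (for \<open>|Dv|\<^sup>q \<rho>\<close>), \<open>1/(tq)\<close> (for \<open>\<rho>\<close> to the power \<open>-t\<close>, controlled
  by the kernel condition) and the positive remainder gives two power-law bounds in \<open>s\<close>.
  Condition (i) makes one of them integrable at 0, condition (iii) makes the other integrable at
  infinity, and splitting at \<open>s = |E|\<close> to the power \<open>1/n\<close> yields the weak-type inequality at the
  critical exponent \<open>q*\<close>. Since it holds for all \<open>C\<^sup>1\<close> functions, applying it to smooth truncations
  of \<open>u\<close> between consecutive dyadic levels and summing (Maz'ya) upgrades it to the strong-type
  inequality, because \<open>q* \<ge> q\<close>. Density is handled by Fatou's lemma along an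
  almost everywhere convergent subsequence.\<close>

section \<open>Integral inequalities\<close>

text \<open>Two applications of the two-term Young inequality: \<open>a\<close> is split off with
  weight \<alpha>, then \<open>b\<close> and \<open>c\<close> are separated with the renormalised
  weights \<open>\<beta>/(1-\<alpha>)\<close> and \<open>\<theta>/(1-\<alpha>)\<close>.\<close>

lemma young3:
  fixes a b c :: real
  assumes "0 < \<alpha>" "0 < \<beta>" "0 < \<theta>" "\<alpha> + \<beta> + \<theta> = 1" "0 \<le> a" "0 \<le> b" "0 \<le> c"
  shows "a powr \<alpha> * b powr \<beta> * c powr \<theta> \<le> \<alpha> * a + \<beta> * b + \<theta> * c"
proof (cases "a = 0 \<or> b = 0 \<or> c = 0")
  case True
  then have "a powr \<alpha> * b powr \<beta> * c powr \<theta> = 0" by auto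
  moreover have "0 \<le> \<alpha> * a + \<beta> * b + \<theta> * c" using assms by (intro add_nonneg_nonneg mult_nonneg_nonneg) auto
  ultimately show ?thesis by linarith
next
  case False
  then have pos: "a > 0" "b > 0" "c > 0" using assms by auto
  have "a powr \<alpha> * b powr \<beta> * c powr \<theta> = a powr \<alpha> * ((b powr (\<beta>/(1-\<alpha>)) * c powr (\<theta>/(1-\<alpha>))) powr (1-\<alpha>))"
    using assms pos by (simp add: powr_mult powr_powr)
  also have "\<dots> \<le> \<alpha> * a + (1-\<alpha>) * (b powr (\<beta>/(1-\<alpha>)) * c powr (\<theta>/(1-\<alpha>)))"
    using assms pos by (intro Youngs_inequality_0) auto
  also have "\<dots> \<le> \<alpha> * a + (1-\<alpha>) * ((\<beta>/(1-\<alpha>)) * b + (\<theta>/(1-\<alpha>)) * c)"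
    using assms pos
    by (intro add_left_mono mult_left_mono Youngs_inequality_0) (auto simp flip: add_divide_distrib)
  also have "\<dots> = \<alpha> * a + \<beta> * b + \<theta> * c"
    using assms by (simp add: distrib_left)
  finally show ?thesis .
qed

text \<open>Dividing \<open>a\<close>, \<open>b\<close>, \<open>c\<close> by the bounds
  \<open>A\<close>, \<open>B\<close>, \<open>C\<close> and applying \<open>young3\<close> pointwise
  gives an integrand whose integral is at most \<alpha> + \<beta> + \<theta> = 1. Working with
  positive upper bounds avoids normalising by integrals that may vanish.\<close>

lemma nn_integral_Holder3:
  fixes a b c :: "'b \<Rightarrow> real"
  assumes \<theta>: "0 < \<alpha>" "0 < \<beta>" "0 < \<theta>" "\<alpha> + \<beta> + \<theta> = 1"
    and [measurable]: "a \<in> borel_measurable M" "b \<in> borel_measurable M" "c \<in> borel_measurable M"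
    and nonneg: "\<And>x. 0 \<le> a x" "\<And>x. 0 \<le> b x" "\<And>x. 0 \<le> c x"
    and pos: "0 < A" "0 < B" "0 < C"
    and le: "(\<integral>\<^sup>+x. a x \<partial>M) \<le> ennreal A" "(\<integral>\<^sup>+x. b x \<partial>M) \<le> ennreal B" "(\<integral>\<^sup>+x. c x \<partial>M) \<le> ennreal C"
  shows "(\<integral>\<^sup>+x. a x powr \<alpha> * b x powr \<beta> * c x powr \<theta> \<partial>M) \<le> ennreal (A powr \<alpha> * B powr \<beta> * C powr \<theta>)"
proof -
  define k where "k = A powr \<alpha> * B powr \<beta> * C powr \<theta>"
  have k: "k > 0" using pos by (simp add: k_def)
  have "a x powr \<alpha> * b x powr \<beta> * c x powr \<theta> \<le> k * (\<alpha>/A) * a x + k * (\<beta>/B) * b x + k * (\<theta>/C) * c x" for x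
  proof -
    have "a x powr \<alpha> * b x powr \<beta> * c x powr \<theta> =
        k * ((a x/A) powr \<alpha> * (b x/B) powr \<beta> * (c x/C) powr \<theta>)"
      using pos nonneg by (simp add: k_def powr_divide)
    also have "\<dots> \<le> k * (\<alpha> * (a x/A) + \<beta> * (b x/B) + \<theta> * (c x/C))"
      using pos nonneg k \<theta> by (intro mult_left_mono young3) auto
    finally show ?thesis by (simp add: algebra_simps)
  qed
  then have "(\<integral>\<^sup>+x. a x powr \<alpha> * b x powr \<beta> * c x powr \<theta> \<partial>M)
      \<le> (\<integral>\<^sup>+x. ennreal (k * (\<alpha>/A)) * ennreal (a x) + ennreal (k * (\<beta>/B)) * ennreal (b x)
            + ennreal (k * (\<theta>/C)) * ennreal (c x) \<partial>M)"
    using pos k \<theta> nonneg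
    by (intro nn_integral_mono) (simp add: ennreal_leI flip: ennreal_mult ennreal_plus)
  also have "\<dots> = ennreal (k * (\<alpha>/A)) * (\<integral>\<^sup>+x. a x \<partial>M) + ennreal (k * (\<beta>/B)) * (\<integral>\<^sup>+x. b x \<partial>M)
            + ennreal (k * (\<theta>/C)) * (\<integral>\<^sup>+x. c x \<partial>M)"
    by (simp add: nn_integral_add nn_integral_cmult)
  also have "\<dots> \<le> ennreal (k * (\<alpha>/A)) * ennreal A + ennreal (k * (\<beta>/B)) * ennreal B
            + ennreal (k * (\<theta>/C)) * ennreal C"
    by (intro add_mono mult_left_mono le) auto
  also have "\<dots> = ennreal (k * (\<alpha>/A) * A + k * (\<beta>/B) * B + k * (\<theta>/C) * C)"
    using pos k \<theta> by (simp flip: ennreal_mult ennreal_plus)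
  also have "k * (\<alpha>/A) * A + k * (\<beta>/B) * B + k * (\<theta>/C) * C = k * (\<alpha> + \<beta> + \<theta>)"
    using pos by (simp add: distrib_left)
  finally show ?thesis using \<theta> by (simp add: k_def)
qed

lemma nn_integral_lborel_affine:
  fixes f :: "'a::euclidean_space \<Rightarrow> ennreal"
  assumes [measurable]: "f \<in> borel_measurable borel" and s: "s > 0"
  shows "(\<integral>\<^sup>+z. f (x + s *\<^sub>R z) \<partial>lborel) = ennreal (s powr (- real DIM('a))) * (\<integral>\<^sup>+y. f y \<partial>lborel)"
proof -
  have "(\<integral>\<^sup>+y. f y \<partial>lborel) = ennreal (s ^ DIM('a)) * (\<integral>\<^sup>+z. f (x + s *\<^sub>R z) \<partial>lborel)"
    using s by (subst lborel_affine[of s x]) (simp_all add: nn_integral_density nn_integral_distr nn_integral_cmult)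
  then have "ennreal (s powr (- real DIM('a))) * (\<integral>\<^sup>+y. f y \<partial>lborel)
     = ennreal (s powr (- real DIM('a)) * s ^ DIM('a)) * (\<integral>\<^sup>+z. f (x + s *\<^sub>R z) \<partial>lborel)"
    using s by (simp add: ennreal_mult mult.assoc)
  also have "s powr (- real DIM('a)) * s ^ DIM('a) = 1"
    using s by (simp add: powr_minus powr_realpow)
  finally show ?thesis by simp
qed

lemma nn_integral_lborel_translate:
  fixes f :: "'a::euclidean_space \<Rightarrow> ennreal"
  assumes [measurable]: "f \<in> borel_measurable borel"
  shows "(\<integral>\<^sup>+x. f (x + z) \<partial>lborel) = (\<integral>\<^sup>+y. f y \<partial>lborel)"
  using nn_integral_lborel_affine[of f 1 z] by (simp add: add.commute)

lemma abs_le_nn_integral_ray: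
  fixes v :: "'a::euclidean_space \<Rightarrow> real"
  assumes v: "C1c_with_grad \<Omega> v Dv" and z: "z \<noteq> 0"
  shows "ennreal \<bar>v x\<bar> \<le> (\<integral>\<^sup>+s. ennreal (norm (Dv (x + s *\<^sub>R z)) * norm z) * indicator {0..} s \<partial>lborel)"
proof -
  have "compact (closure {x. v x \<noteq> 0})" using v by (simp add: C1c_with_grad_def)
  then obtain B where B: "norm y \<le> B" if "v y \<noteq> 0" for y
    using compact_imp_bounded[of "closure {x. v x \<noteq> 0}"] closure_subset[of "{x. v x \<noteq> 0}"]
    by (auto simp: bounded_iff subset_iff)
  \<comment> \<open>The length of \<open>S z\<close> makes \<open>x + S z\<close> have norm at least
    |B| + 1, hence lie outside the support.\<close>
  define S where "S = (norm x + \<bar>B\<bar> + 1) / norm z"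
  have S: "S > 0" "S * norm z = norm x + \<bar>B\<bar> + 1" using z by (auto simp: S_def divide_simps add_nonneg_pos)
  have "norm (x + S *\<^sub>R z) \<ge> norm (S *\<^sub>R z) - norm x"
    by (metis add.commute norm_diff_ineq)
  then have vS: "v (x + S *\<^sub>R z) = 0" using B[of "x + S *\<^sub>R z"] S by fastforce
  have der: "(v has_derivative (\<lambda>h. Dv y \<bullet> h)) (at y)" for y
    using v by (simp add: C1c_with_grad_def)
  have cont: "continuous_on UNIV Dv" using v by (simp add: C1c_with_grad_def)
  have "((\<lambda>s. v (x + s *\<^sub>R z)) has_vector_derivative (Dv (x + s *\<^sub>R z) \<bullet> z)) (at s within {0..S})" for s
  proof -
    have "((\<lambda>s. v (x + s *\<^sub>R z)) has_derivative (\<lambda>h. Dv (x + s *\<^sub>R z) \<bullet> (h *\<^sub>R z))) (at s within {0..S})"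
      by (rule has_derivative_compose[where f = "\<lambda>s. x + s *\<^sub>R z", OF _ der])
         (auto intro!: derivative_eq_intros)
    then show ?thesis by (simp add: has_vector_derivative_def mult.commute)
  qed
  then have "((\<lambda>s. Dv (x + s *\<^sub>R z) \<bullet> z) has_integral (v (x + S *\<^sub>R z) - v (x + 0 *\<^sub>R z))) {0..S}"
    using S by (intro fundamental_theorem_of_calculus) auto
  then have int: "((\<lambda>s. Dv (x + s *\<^sub>R z) \<bullet> z) has_integral (- v x)) {0..S}"
    using vS by simp
  have "(\<lambda>s. norm (Dv (x + s *\<^sub>R z)) * norm z) integrable_on {0..S}"
    by (intro integrable_continuous_real continuous_intros continuous_on_compose2[OF cont]) auto
  then obtain J where J: "((\<lambda>s. norm (Dv (x + s *\<^sub>R z)) * norm z) has_integral J) {0..S}"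
    by (auto simp: integrable_on_def)
  have "norm (integral {0..S} (\<lambda>s. Dv (x + s *\<^sub>R z) \<bullet> z)) \<le> integral {0..S} (\<lambda>s. norm (Dv (x + s *\<^sub>R z)) * norm z)"
    using int J by (intro integral_norm_bound_integral) (auto simp: integrable_on_def Cauchy_Schwarz_ineq2)
  then have "\<bar>v x\<bar> \<le> J" using int J by (auto dest!: integral_unique)
  then have "ennreal \<bar>v x\<bar> \<le> ennreal J" by (rule ennreal_leI)
  also have "\<dots> = (\<integral>\<^sup>+s. ennreal (norm (Dv (x + s *\<^sub>R z)) * norm z) * indicator {0..S} s \<partial>lborel)"
    using nn_integral_has_integral_lebesgue'[OF _ J] by simp
  also have "\<dots> \<le> (\<integral>\<^sup>+s. ennreal (norm (Dv (x + s *\<^sub>R z)) * norm z) * indicator {0..} s \<partial>lborel)"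
    by (intro nn_integral_mono) (auto simp: indicator_def)
  finally show ?thesis .
qed

lemma nn_integral_powr_from_0:
  assumes "a > -1" "R \<ge> 0"
  shows "(\<integral>\<^sup>+s. ennreal (s powr a) * indicator {0..R} s \<partial>lborel) = ennreal (R powr (a+1) / (a+1))"
  using nn_integral_has_integral_lebesgue'[OF _ has_integral_powr_from_0[OF assms]] by simp

lemma nn_integral_powr_to_inf:
  assumes "a < -1" "R > 0"
  shows "(\<integral>\<^sup>+s. ennreal (s powr a) * indicator {R..} s \<partial>lborel) = ennreal (- (R powr (a+1)) / (a+1))"
  using nn_integral_has_integral_lebesgue'[OF _ has_integral_powr_to_inf[OF assms]] by simp

section \<open>Compactly supported functions and their truncations\<close>

lemma C1c_with_gradD:
  assumes "C1c_with_grad \<Omega> v Dv"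
  shows "(v has_derivative (\<lambda>h. Dv x \<bullet> h)) (at x)" "continuous_on UNIV Dv" "continuous_on UNIV v"
    "compact (closure {x. v x \<noteq> 0})" "closure {x. v x \<noteq> 0} \<subseteq> \<Omega>"
proof -
  show der: "(v has_derivative (\<lambda>h. Dv x \<bullet> h)) (at x)" for x
    using assms unfolding C1c_with_grad_def by blast
  show "continuous_on UNIV v"
    using der has_derivative_continuous by (intro continuous_at_imp_continuous_on) blast
qed (use assms in \<open>unfold C1c_with_grad_def, blast+\<close>)

text \<open>\<open>v\<close> vanishes on a neighbourhood of each point off its support, so
  uniqueness of derivatives applies. This lets integrals of gradient energies over \<Omega> be taken
  over the whole space.\<close>

lemma C1c_grad_eq_0:
  fixes v :: "'a::euclidean_space \<Rightarrow> real"
  assumes v: "C1c_with_grad \<Omega> v Dv" and x: "x \<notin> \<Omega>"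
  shows "Dv x = 0"
proof -
  let ?S = "- closure {x. v x \<noteq> 0}"
  have xS: "x \<in> ?S" using x C1c_with_gradD(5)[OF v] by blast
  have v0: "0 = v y" if "y \<in> ?S" for y
    using that closure_subset[of "{x. v x \<noteq> 0}"] by fastforce
  have "(v has_derivative (\<lambda>h. 0)) (at x)"
    by (rule has_derivative_transform_within_open[OF has_derivative_const open_Compl[OF closed_closure] xS v0])
  then have "(\<lambda>h. Dv x \<bullet> h) = (\<lambda>h. 0)"
    using C1c_with_gradD(1)[OF v] has_derivative_unique by blast
  then show ?thesis by (metis inner_eq_zero_iff)
qed

lemma C1c_compact_superlevel:
  fixes v :: "'a::euclidean_space \<Rightarrow> real"
  assumes v: "C1c_with_grad \<Omega> v Dv" and "c > 0"
  shows "compact {x. c \<le> \<bar>v x\<bar>}" "{x. c \<le> \<bar>v x\<bar>} \<subseteq> \<Omega>"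
proof -
  have cl: "closed {x. c \<le> \<bar>v x\<bar>}"
    using C1c_with_gradD(3)[OF v] by (intro closed_Collect_le continuous_intros) auto
  have sub: "{x. c \<le> \<bar>v x\<bar>} \<subseteq> closure {x. v x \<noteq> 0}"
    using \<open>c > 0\<close> closure_subset[of "{x. v x \<noteq> 0}"] by auto
  show "compact {x. c \<le> \<bar>v x\<bar>}"
    using compact_Int_closed[OF C1c_with_gradD(4)[OF v] cl] sub by (simp add: Int_absorb1)
  show "{x. c \<le> \<bar>v x\<bar>} \<subseteq> \<Omega>" using sub C1c_with_gradD(5)[OF v] by auto
qed

text \<open>Only \<open>r = 0\<close> needs an argument: there the difference quotient is at most
  \<open>\<bar>h\<bar>\<close> in absolute value.\<close>

lemma has_real_derivative_pos_part_sq: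
  "((\<lambda>r::real. (max 0 r)\<^sup>2) has_real_derivative 2 * max 0 r) (at r)"
proof -
  consider "r < 0" | "r > 0" | "r = 0" by linarith
  then show ?thesis
  proof cases
    case 1
    have "((\<lambda>r::real. 0) has_real_derivative 0) (at r)" by simp
    then have "((\<lambda>r::real. (max 0 r)\<^sup>2) has_real_derivative 0) (at r)"
      by (rule has_field_derivative_transform_within_open[of _ _ _ "{..<0}"]) (use 1 in auto)
    then show ?thesis using 1 by simp
  next
    case 2
    have "((\<lambda>r::real. r\<^sup>2) has_real_derivative 2 * r) (at r)"
      by (auto intro!: derivative_eq_intros)
    then have "((\<lambda>r::real. (max 0 r)\<^sup>2) has_real_derivative 2 * r) (at r)"
      by (rule has_field_derivative_transform_within_open[of _ _ _ "{0<..}"]) (use 2 in auto)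
    then show ?thesis using 2 by simp
  next
    case 3
    have "((\<lambda>h::real. (max 0 h)\<^sup>2 / h) \<longlongrightarrow> 0) (at 0)"
    proof (rule Lim_null_comparison)
      show "\<forall>\<^sub>F h in at 0. norm ((max 0 h)\<^sup>2 / h) \<le> \<bar>h::real\<bar>"
        by (rule always_eventually) (auto simp: max_def power2_eq_square abs_mult)
      show "((\<lambda>h::real. \<bar>h\<bar>) \<longlongrightarrow> 0) (at 0)"
        by (auto intro!: tendsto_eq_intros)
    qed
    then show ?thesis using 3 by (simp add: has_field_derivative_iff)
  qed
qed

text \<open>A \<open>C\<^sup>1\<close> step from 0 (for \<open>r \<le> 1\<close>) to 1 (for \<open>r \<ge> 2\<close>). It is applied to
  \<open>u\<^sup>2 / a\<close> rather than to a multiple of \<open>|u|\<close>, which is not differentiable.\<close>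

definition step_fun :: "real \<Rightarrow> real" where
  "step_fun r = 2 * ((max 0 (r - 1))\<^sup>2 - 2 * (max 0 (r - 3/2))\<^sup>2 + (max 0 (r - 2))\<^sup>2)"

text \<open>The tent function on [1, 2] with peak 2 at 3/2.\<close>

definition step_deriv :: "real \<Rightarrow> real" where
  "step_deriv r = 4 * (max 0 (r - 1) - 2 * max 0 (r - 3/2) + max 0 (r - 2))"

lemma has_derivative_step_fun: "(step_fun has_real_derivative step_deriv r) (at r)"
proof -
  have p: "((\<lambda>r. (max 0 (r - a))\<^sup>2) has_real_derivative 2 * max 0 (r - a)) (at r)" for a
  proof -
    have "((\<lambda>r. r - a) has_real_derivative 1) (at r)" by (auto intro!: derivative_eq_intros)
    from DERIV_chain2[where f = "\<lambda>r. (max 0 r)\<^sup>2", OF has_real_derivative_pos_part_sq this]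
    show ?thesis by simp
  qed
  show ?thesis
    unfolding step_fun_def[abs_def] step_deriv_def
    by (rule derivative_eq_intros p refl)+ simp
qed

lemma continuous_on_step_deriv: "continuous_on A step_deriv"
  unfolding step_deriv_def[abs_def] by (intro continuous_intros)

lemma step_deriv_bounds: "\<bar>step_deriv r\<bar> \<le> 2" "r < 1 \<or> 2 \<le> r \<Longrightarrow> step_deriv r = 0"
  by (auto simp: step_deriv_def max_def)

lemma step_fun_eq: "r \<le> 1 \<Longrightarrow> step_fun r = 0" "2 \<le> r \<Longrightarrow> step_fun r = 1"
  by (auto simp: step_fun_def max_def power2_eq_square algebra_simps)

text \<open>The chain rule gives the gradient. Since \<open>step_fun\<close> vanishes at 0, the
  support does not grow, so the truncation may be fed into the weak-type inequality on the same
  \<Omega>.\<close>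

lemma C1c_with_grad_truncation:
  fixes u :: "'a::euclidean_space \<Rightarrow> real"
  assumes u: "C1c_with_grad \<Omega> u Du" and "a > 0"
  shows "C1c_with_grad \<Omega> (\<lambda>x. step_fun ((u x)\<^sup>2 / a)) (\<lambda>x. (step_deriv ((u x)\<^sup>2 / a) * (2 * u x / a)) *\<^sub>R Du x)"
proof -
  note der = C1c_with_gradD(1)[OF u] and Du = C1c_with_gradD(2)[OF u] and cu = C1c_with_gradD(3)[OF u]
    and cpt = C1c_with_gradD(4)[OF u] and sub = C1c_with_gradD(5)[OF u]
  have "((\<lambda>x. step_fun ((u x)\<^sup>2 / a)) has_derivative
      (\<lambda>h. ((step_deriv ((u x)\<^sup>2 / a) * (2 * u x / a)) *\<^sub>R Du x) \<bullet> h)) (at x)" for x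
  proof -
    have "((\<lambda>x. (u x)\<^sup>2 / a) has_derivative (\<lambda>h. (2 * u x / a) * (Du x \<bullet> h))) (at x)"
      using \<open>a > 0\<close> by (auto intro!: derivative_eq_intros der simp: field_simps)
    from has_derivative_compose[OF this, of step_fun "(*) (step_deriv ((u x)\<^sup>2 / a))"]
    show ?thesis
      using has_derivative_step_fun[of "(u x)\<^sup>2 / a"]
      by (simp add: has_field_derivative_def mult.assoc)
  qed
  moreover have "continuous_on UNIV (\<lambda>x. (step_deriv ((u x)\<^sup>2 / a) * (2 * u x / a)) *\<^sub>R Du x)"
    using \<open>a > 0\<close> by (intro continuous_intros continuous_on_compose2[OF continuous_on_step_deriv] cu Du) auto
  moreover have cl: "closure {x. step_fun ((u x)\<^sup>2 / a) \<noteq> 0} \<subseteq> closure {x. u x \<noteq> 0}"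
    by (intro closure_mono) (auto simp: step_fun_eq)
  moreover have "compact (closure {x. step_fun ((u x)\<^sup>2 / a) \<noteq> 0})"
    using compact_Int_closed[OF cpt closed_closure] cl by (metis Int_absorb1)
  ultimately show ?thesis
    using sub unfolding C1c_with_grad_def by blast
qed

text \<open>Writing the sum over levels as an integral against counting measure lets it be exchanged
  with the integral over \<open>x\<close>; disjointness then leaves at most one non-zero term at
  each point.\<close>

lemma nn_integral_count_space_indicator_disjoint:
  fixes D :: "int \<Rightarrow> 'a set" and f :: "'a \<Rightarrow> ennreal"
  assumes [measurable]: "f \<in> borel_measurable M" "\<And>k. D k \<in> sets M"
    and disj: "\<And>x k l. x \<in> D k \<Longrightarrow> x \<in> D l \<Longrightarrow> k = l"
  shows "(\<integral>\<^sup>+k. \<integral>\<^sup>+x. f x * indicator (D k) x \<partial>M \<partial>count_space UNIV) = (\<integral>\<^sup>+x. f x * indicator (\<Union>k. D k) x \<partial>M)"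
proof -
  have "(\<integral>\<^sup>+k. f x * indicator (D k) x \<partial>count_space UNIV) = f x * indicator (\<Union>k. D k) x" for x
  proof (cases "\<exists>k. x \<in> D k")
    case True
    then obtain k where k: "x \<in> D k" by auto
    have "{k. x \<in> D k} = {k}" using disj k by blast
    moreover have "(\<integral>\<^sup>+k. indicator (D k) x \<partial>count_space UNIV) = (\<integral>\<^sup>+k. indicator {k. x \<in> D k} k \<partial>count_space (UNIV :: int set))"
      by (intro nn_integral_cong) (simp add: indicator_def)
    ultimately have "(\<integral>\<^sup>+k. indicator (D k) x \<partial>count_space UNIV) = 1"
      by simp
    then show ?thesis using k by (auto simp: nn_integral_cmult indicator_def)
  qed simp
  then show ?thesis
    by (subst nn_integral_count_space_nn_integral[symmetric]) auto
qed

section \<open>The weak-type inequality\<close>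

text \<open>The dimension \<open>N\<close> and the direction \<open>b\<close> are parameters because otherwise the
  constants defined from them would depend on the type \<open>'a\<close> only through a hidden
  type argument.\<close>

locale kernel_weight =
  fixes \<Omega> :: "'a::euclidean_space set" and \<rho> :: "'a \<Rightarrow> real" and t \<gamma> K q N :: real and b :: 'a
  assumes open_\<Omega>: "open \<Omega>"
    and N_eq: "N = real DIM('a)" and norm_b: "norm b = 1"
    and \<rho>_borel [measurable]: "\<rho> \<in> borel_measurable borel"
    and \<rho>_pos: "\<rho> x > 0"
    and t_pos: "t > 0" and \<gamma>_less: "\<gamma> < N" and K_pos: "K > 0"
    and kernel_le: "x \<in> \<Omega> \<Longrightarrow>
      (\<integral>\<^sup>+y. ennreal (1 / (\<rho> y powr t * norm (x - y) powr \<gamma>)) * indicator \<Omega> y \<partial>lborel) \<le> ennreal K"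
    and q_gt: "q > (N - \<gamma>) / t"
    and q_gt': "q > 1 + 1 / t"
    and q_less: "q < (N - \<gamma>) / t + N"
begin

section \<open>The exponents and their ranges\<close>

lemma N_pos: "N > 0" by (simp add: N_eq)

text \<open>The small-scale slice bound turns out to be a multiple of
  \<open>s powr (- \<delta>)\<close>.\<close>

definition \<delta> :: real where "\<delta> = (N - \<gamma>) / (t * q)"

text \<open>The critical exponent of the theorem, with its reciprocal rewritten in terms of
  \<delta>.\<close>

definition qs :: real where "qs = 1 / (1 / q + (\<delta> - 1) / N)"

lemma q_gt_1: "q > 1" using q_gt' t_pos by (smt (verit) divide_pos_pos)

lemma \<delta>_pos: "\<delta> > 0" using \<gamma>_less t_pos q_gt_1 by (simp add: \<delta>_def)

text \<open>Condition (i) in terms of \<delta>: it makes \<open>s powr (- \<delta>)\<close>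
  integrable at 0.\<close>

lemma \<delta>_less_1: "\<delta> < 1"
  using q_gt t_pos q_gt_1 by (simp add: \<delta>_def divide_simps mult.commute)

text \<open>Condition (iii) in terms of \<delta>: it makes
  \<open>s powr (- \<delta> - N / q)\<close> integrable at infinity, and it also makes
  \<open>qs\<close> positive.\<close>

lemma \<delta>_decay: "\<delta> + N / q > 1"
proof -
  have "q * t < (N - \<gamma>) + N * t" using q_less t_pos by (simp add: field_simps)
  then show ?thesis using t_pos q_gt_1 by (simp add: \<delta>_def field_simps)
qed

lemma inverse_qs: "1 / qs = 1 / q + (\<delta> - 1) / N" by (simp add: qs_def)

lemma qs_pos: "qs > 0"
proof -
  have "N * (1 / q + (\<delta> - 1) / N) > 0" using \<delta>_decay N_pos by (simp add: distrib_left)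
  then have "1 / q + (\<delta> - 1) / N > 0" using N_pos by (simp add: zero_less_mult_iff)
  then show ?thesis by (simp add: qs_def)
qed

lemma qs_gt_q: "qs > q"
proof -
  have "(\<delta> - 1) / N < 0" using \<delta>_less_1 N_pos by (simp add: divide_neg_pos)
  then have "1 / qs < 1 / q" using inverse_qs by linarith
  then show ?thesis using q_gt_1 qs_pos by (simp add: divide_simps split: if_splits)
qed

text \<open>Averaging the fundamental theorem of calculus over all rays \<open>x + s z\<close> with \<open>z \<in> D\<close>
  replaces polar coordinates; any bounded open set away from the origin would do for \<open>D\<close>.\<close>

definition D :: "'a set" where "D = ball (2 *\<^sub>R b) 1"

lemma D_borel [measurable]: "D \<in> sets borel" by (simp add: D_def)

lemma norm_D: assumes "z \<in> D" shows "1 < norm z" "norm z < 3"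
proof -
  have b: "norm (2 *\<^sub>R b) = 2" using norm_b by simp
  have "norm (2 *\<^sub>R b - z) < 1" using assms by (simp add: D_def dist_norm)
  then show "1 < norm z" "norm z < 3"
    using b norm_triangle_ineq2[of "2 *\<^sub>R b" z] norm_triangle_ineq2[of z "2 *\<^sub>R b"]
    by (auto simp: norm_minus_commute)
qed

definition m :: real where "m = measure lborel D"

lemma m_pos: "m > 0" by (simp add: m_def D_def content_ball_pos)

lemma emeasure_D: "emeasure lborel D = ennreal m"
  unfolding m_def D_def by (rule emeasure_eq_ennreal_measure) (use emeasure_lborel_ball_finite[of "2 *\<^sub>R b" 1] in simp)

definition \<Lambda> :: real where "\<Lambda> = 3 powr \<bar>\<gamma>\<bar> * K"

lemma \<Lambda>_pos: "\<Lambda> > 0" using K_pos by (simp add: \<Lambda>_def)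

text \<open>The factor controlled by the kernel condition, cut off outside \<Omega> because that
  condition integrates over \<Omega> only.\<close>

definition H :: "'a \<Rightarrow> real" where "H y = (if y \<in> \<Omega> then \<rho> y powr (- t) else 0)"

lemma H_borel [measurable]: "H \<in> borel_measurable borel"
proof -
  have [measurable]: "\<Omega> \<in> sets borel" using open_\<Omega> by simp
  show ?thesis unfolding H_def by measurable
qed

lemma H_nonneg: "0 \<le> H y" by (simp add: H_def)

text \<open>Substituting \<open>y = x + s z\<close> in the kernel condition at \<open>x\<close>
  produces the Jacobian \<open>s powr (- N)\<close>. Since |x - y| = s |z| with 1 < |z| < 3 on
  \<open>D\<close>, restoring the kernel costs \<open>s powr \<gamma>\<close> and a
  constant.\<close>

lemma nn_integral_H_le:
  assumes "x \<in> \<Omega>" "s > 0"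
  shows "(\<integral>\<^sup>+z. ennreal (H (x + s *\<^sub>R z)) * indicator D z \<partial>lborel) \<le> ennreal (\<Lambda> * s powr (\<gamma> - N))"
proof -
  have [measurable]: "\<Omega> \<in> sets borel" using open_\<Omega> by simp
  define g where "g y = ennreal (1 / (\<rho> y powr t * norm (x - y) powr \<gamma>)) * indicator \<Omega> y" for y
  have [measurable]: "g \<in> borel_measurable borel" unfolding g_def by measurable
  have *: "ennreal (H (x + s *\<^sub>R z)) * indicator D z \<le> ennreal (3 powr \<bar>\<gamma>\<bar> * s powr \<gamma>) * g (x + s *\<^sub>R z)" for z
  proof (cases "z \<in> D \<and> x + s *\<^sub>R z \<in> \<Omega>")
    case True
    then have z: "1 < norm z" "norm z < 3" using norm_D by auto
    \<comment> \<open>The absolute value in the exponent covers both signs of \<gamma>.\<close>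
    have "norm z powr \<gamma> \<le> 3 powr \<bar>\<gamma>\<bar>"
    proof -
      have "norm z powr \<gamma> \<le> norm z powr \<bar>\<gamma>\<bar>" using z by (intro powr_mono) auto
      also have "\<dots> \<le> 3 powr \<bar>\<gamma>\<bar>" using z by (intro powr_mono2) auto
      finally show ?thesis .
    qed
    moreover have "\<rho> (x + s *\<^sub>R z) powr t > 0" "norm z powr \<gamma> > 0" using z \<rho>_pos[of "x + s *\<^sub>R z"] by auto
    ultimately have "1 / \<rho> (x + s *\<^sub>R z) powr t \<le> 3 powr \<bar>\<gamma>\<bar> * s powr \<gamma> * (1 / (\<rho> (x + s *\<^sub>R z) powr t * (s powr \<gamma> * norm z powr \<gamma>)))"
      using assms(2) by (simp add: field_simps)
    then have "\<rho> (x + s *\<^sub>R z) powr (- t) \<le> 3 powr \<bar>\<gamma>\<bar> * s powr \<gamma> * (1 / (\<rho> (x + s *\<^sub>R z) powr t * norm (s *\<^sub>R z) powr \<gamma>))"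
      using assms(2) by (simp add: powr_minus_divide powr_mult)
    then show ?thesis using True by (simp add: H_def g_def ennreal_leI flip: ennreal_mult)
  qed (auto simp: H_def)
  have "(\<integral>\<^sup>+z. ennreal (H (x + s *\<^sub>R z)) * indicator D z \<partial>lborel)
      \<le> (\<integral>\<^sup>+z. ennreal (3 powr \<bar>\<gamma>\<bar> * s powr \<gamma>) * g (x + s *\<^sub>R z) \<partial>lborel)"
    by (intro nn_integral_mono *)
  also have "\<dots> = ennreal (3 powr \<bar>\<gamma>\<bar> * s powr \<gamma>) * (ennreal (s powr (- N)) * (\<integral>\<^sup>+y. g y \<partial>lborel))"
    using assms by (simp add: nn_integral_cmult nn_integral_lborel_affine N_eq)
  also have "\<dots> \<le> ennreal (3 powr \<bar>\<gamma>\<bar> * s powr \<gamma>) * (ennreal (s powr (- N)) * ennreal K)"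
    using kernel_le[OF assms(1)] by (intro mult_left_mono) (auto simp: g_def)
  also have "\<dots> = ennreal (\<Lambda> * s powr (\<gamma> - N))"
    using K_pos by (simp add: \<Lambda>_def powr_diff powr_minus field_simps flip: ennreal_mult)
  finally show ?thesis .
qed

section \<open>Hoelder's inequality on a slice\<close>

abbreviation \<theta>\<^sub>1 :: real where "\<theta>\<^sub>1 \<equiv> 1 / q"
abbreviation \<theta>\<^sub>2 :: real where "\<theta>\<^sub>2 \<equiv> 1 / (t * q)"
abbreviation \<theta>\<^sub>3 :: real where "\<theta>\<^sub>3 \<equiv> 1 - 1 / q - 1 / (t * q)"

text \<open>This is condition (ii): the first two Hoelder exponents add up to
  \<open>(t + 1) / (t * q)\<close>, which is less than 1.\<close>

lemma \<theta>\<^sub>3_pos: "\<theta>\<^sub>3 > 0"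
proof -
  have "t * q > t + 1" using q_gt' t_pos by (simp add: field_simps)
  then have "(t + 1) / (t * q) < 1" using t_pos q_gt_1 by (simp add: mult.commute)
  then show ?thesis using t_pos q_gt_1 by (simp add: add_divide_distrib)
qed

text \<open>The two choices of \<open>W\<close> come from integrating \<open>f\<^sup>q \<rho>\<close> first in \<open>x\<close>, or first in \<open>z\<close>.
  The former is the better bound for small \<open>s\<close>, the latter for large \<open>s\<close>.\<close>

lemma nn_integral_slice_le:
  fixes f :: "'a \<Rightarrow> real" and E :: "'a set"
  assumes [measurable]: "f \<in> borel_measurable borel" and f: "\<And>x. 0 \<le> f x" "\<And>x. x \<notin> \<Omega> \<Longrightarrow> f x = 0"
    and [measurable]: "E \<in> sets borel" and E: "E \<subseteq> \<Omega>" "emeasure lborel E = ennreal e" "e > 0"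
    and P: "(\<integral>\<^sup>+y. ennreal (f y powr q * \<rho> y) \<partial>lborel) \<le> ennreal P" "P > 0" and s: "s > 0"
    and W: "W = m * P \<or> W = e * s powr (- N) * P"
  shows "(\<integral>\<^sup>+z. \<integral>\<^sup>+x. ennreal (f (x + s *\<^sub>R z)) * indicator E x * indicator D z \<partial>lborel \<partial>lborel)
     \<le> ennreal (W powr \<theta>\<^sub>1 * (\<Lambda> * s powr (\<gamma> - N) * e) powr \<theta>\<^sub>2 * (m * e) powr \<theta>\<^sub>3)"
proof -
  define M where "M = (lborel \<Otimes>\<^sub>M lborel :: ('a \<times> 'a) measure)"
  have sets_M [measurable_cong]: "sets M = sets (borel \<Otimes>\<^sub>M borel)"
    unfolding M_def by (intro sets_pair_measure_cong) auto
  define i where "i = (\<lambda>(z, x). indicator E x * indicator D z :: real)"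
  define p where "p = (\<lambda>(z, x). f (x + s *\<^sub>R z) powr q * \<rho> (x + s *\<^sub>R z))"
  define h where "h = (\<lambda>(z, x). H (x + s *\<^sub>R z))"
  have [measurable]: "i \<in> borel_measurable M" "p \<in> borel_measurable M" "h \<in> borel_measurable M"
    unfolding i_def p_def h_def by measurable
  have [simp]: "0 \<le> i w" "0 \<le> p w" "0 \<le> h w" for w
    using \<rho>_pos by (auto simp: i_def p_def h_def H_nonneg less_imp_le split: prod.splits)
  have fst: "(\<integral>\<^sup>+w. F w \<partial>M) = (\<integral>\<^sup>+z. \<integral>\<^sup>+x. F (z, x) \<partial>lborel \<partial>lborel)"
    and snd: "(\<integral>\<^sup>+w. F w \<partial>M) = (\<integral>\<^sup>+x. \<integral>\<^sup>+z. F (z, x) \<partial>lborel \<partial>lborel)"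
    if "F \<in> borel_measurable M" for F :: "'a \<times> 'a \<Rightarrow> ennreal"
    using that lborel.nn_integral_fst[of F lborel] lborel_pair.nn_integral_snd[of F] by (simp_all add: M_def)
  have W_pos: "W > 0" using W m_pos P(2) E(3) s by auto
  have p_le: "(\<integral>\<^sup>+w. ennreal (p w * i w) \<partial>M) \<le> ennreal W"
    using W
  proof
    assume W: "W = m * P"
    \<comment> \<open>The restriction to \<open>E\<close> is dropped; translation invariance then
      bounds the inner integral by \<open>P\<close> for every \<open>z\<close>, and \<open>D\<close>
      contributes its measure \<open>m\<close>.\<close>
    have "(\<integral>\<^sup>+w. ennreal (p w * i w) \<partial>M) \<le> (\<integral>\<^sup>+z. \<integral>\<^sup>+x. ennreal (f (x + s *\<^sub>R z) powr q * \<rho> (x + s *\<^sub>R z)) * indicator D z \<partial>lborel \<partial>lborel)"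
      by (subst fst) (auto simp: p_def i_def intro!: nn_integral_mono split: split_indicator)
    also have "\<dots> = (\<integral>\<^sup>+z. (\<integral>\<^sup>+x. ennreal (f (x + s *\<^sub>R z) powr q * \<rho> (x + s *\<^sub>R z)) \<partial>lborel) * indicator D z \<partial>lborel)"
      by (simp add: nn_integral_multc)
    also have "\<dots> = (\<integral>\<^sup>+z. (\<integral>\<^sup>+x. ennreal (f x powr q * \<rho> x) \<partial>lborel) * indicator D z \<partial>lborel)"
      by (subst nn_integral_lborel_translate[where f="\<lambda>x. ennreal (f x powr q * \<rho> x)"]) auto
    also have "\<dots> \<le> (\<integral>\<^sup>+z. ennreal P * indicator D z \<partial>lborel)"
      by (intro nn_integral_mono mult_right_mono P) auto
    also have "\<dots> = ennreal W" using W P(2) m_pos by (simp add: nn_integral_cmult emeasure_D mult.commute flip: ennreal_mult)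
    finally show ?thesis .
  next
    assume W: "W = e * s powr (- N) * P"
    \<comment> \<open>The restriction to \<open>D\<close> is dropped; scaling in \<open>z\<close>
      gives \<open>s powr (- N)\<close> times \<open>P\<close> for every \<open>x\<close>, and
      \<open>E\<close> contributes its measure \<open>e\<close>.\<close>
    have "(\<integral>\<^sup>+w. ennreal (p w * i w) \<partial>M) \<le> (\<integral>\<^sup>+x. \<integral>\<^sup>+z. ennreal (f (x + s *\<^sub>R z) powr q * \<rho> (x + s *\<^sub>R z)) * indicator E x \<partial>lborel \<partial>lborel)"
      by (subst snd) (auto simp: p_def i_def intro!: nn_integral_mono split: split_indicator)
    also have "\<dots> = (\<integral>\<^sup>+x. (\<integral>\<^sup>+z. ennreal (f (x + s *\<^sub>R z) powr q * \<rho> (x + s *\<^sub>R z)) \<partial>lborel) * indicator E x \<partial>lborel)"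
      by (simp add: nn_integral_multc)
    also have "\<dots> = (\<integral>\<^sup>+x. ennreal (s powr (- N)) * (\<integral>\<^sup>+x. ennreal (f x powr q * \<rho> x) \<partial>lborel) * indicator E x \<partial>lborel)"
      using s by (subst nn_integral_lborel_affine[where f="\<lambda>x. ennreal (f x powr q * \<rho> x)"]) (auto simp: N_eq)
    also have "\<dots> \<le> (\<integral>\<^sup>+x. ennreal (s powr (- N)) * ennreal P * indicator E x \<partial>lborel)"
      by (intro nn_integral_mono mult_right_mono mult_left_mono P) auto
    also have "\<dots> = ennreal (s powr (- N)) * ennreal P * ennreal e"
      by (simp add: nn_integral_cmult E(2))
    also have "\<dots> = ennreal W" using W P(2) E(3) by (simp add: mult_ac flip: ennreal_mult)
    finally show ?thesis .
  qed
  have h_le: "(\<integral>\<^sup>+w. ennreal (h w * i w) \<partial>M) \<le> ennreal (\<Lambda> * s powr (\<gamma> - N) * e)"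
  proof -
    have "(\<integral>\<^sup>+w. ennreal (h w * i w) \<partial>M) = (\<integral>\<^sup>+x. \<integral>\<^sup>+z. ennreal (H (x + s *\<^sub>R z)) * indicator D z * indicator E x \<partial>lborel \<partial>lborel)"
      by (subst snd) (auto simp: h_def i_def intro!: nn_integral_cong split: split_indicator)
    also have "\<dots> = (\<integral>\<^sup>+x. (\<integral>\<^sup>+z. ennreal (H (x + s *\<^sub>R z)) * indicator D z \<partial>lborel) * indicator E x \<partial>lborel)"
      by (simp add: nn_integral_multc)
    also have "\<dots> \<le> (\<integral>\<^sup>+x. ennreal (\<Lambda> * s powr (\<gamma> - N)) * indicator E x \<partial>lborel)"
      using nn_integral_H_le[OF _ s] E(1) by (intro nn_integral_mono) (auto split: split_indicator)
    also have "\<dots> = ennreal (\<Lambda> * s powr (\<gamma> - N) * e)"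
      using E \<Lambda>_pos by (simp add: nn_integral_cmult flip: ennreal_mult)
    finally show ?thesis .
  qed
  have i_le: "(\<integral>\<^sup>+w. ennreal (i w) \<partial>M) \<le> ennreal (m * e)"
  proof -
    have "(\<integral>\<^sup>+w. ennreal (i w) \<partial>M) = (\<integral>\<^sup>+z. \<integral>\<^sup>+x. indicator E x * indicator D z \<partial>lborel \<partial>lborel)"
      by (subst fst) (auto simp: i_def intro!: nn_integral_cong split: split_indicator)
    also have "\<dots> = ennreal (m * e)"
      using E m_pos by (simp add: nn_integral_multc nn_integral_cmult emeasure_D mult.commute flip: ennreal_mult)
    finally show ?thesis by simp
  qed
  have "(\<integral>\<^sup>+z. \<integral>\<^sup>+x. ennreal (f (x + s *\<^sub>R z)) * indicator E x * indicator D z \<partial>lborel \<partial>lborel)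
     = (\<integral>\<^sup>+w. (\<lambda>(z, x). ennreal (f (x + s *\<^sub>R z)) * indicator E x * indicator D z) w \<partial>M)"
    by (subst fst) auto
  also have "\<dots> = (\<integral>\<^sup>+w. ennreal ((p w * i w) powr \<theta>\<^sub>1 * (h w * i w) powr \<theta>\<^sub>2 * i w powr \<theta>\<^sub>3) \<partial>M)"
  proof (intro nn_integral_cong)
    fix w :: "'a \<times> 'a"
    obtain z x where w: "w = (z, x)" by (cases w)
    \<comment> \<open>The powers of the weight cancel: \<open>\<rho> powr (1 / q)\<close> against
      \<open>(\<rho> powr (- t)) powr (1 / (t * q))\<close>. Outside \<Omega> both sides are 0. The
      indicator \<open>i\<close> equals its own positive powers, so it can be shared among the three
      factors.\<close>
    have "f y = (f y powr q * \<rho> y) powr \<theta>\<^sub>1 * H y powr \<theta>\<^sub>2" for y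
      using f[of y] \<rho>_pos[of y] q_gt_1 t_pos
      by (cases "y \<in> \<Omega>") (auto simp: H_def powr_mult powr_powr simp flip: powr_add)
    then show "(\<lambda>(z, x). ennreal (f (x + s *\<^sub>R z)) * indicator E x * indicator D z) w
        = ennreal ((p w * i w) powr \<theta>\<^sub>1 * (h w * i w) powr \<theta>\<^sub>2 * i w powr \<theta>\<^sub>3)"
      by (auto simp: w p_def h_def i_def split: split_indicator)
  qed
  also have "\<dots> \<le> ennreal (W powr \<theta>\<^sub>1 * (\<Lambda> * s powr (\<gamma> - N) * e) powr \<theta>\<^sub>2 * (m * e) powr \<theta>\<^sub>3)"
    using \<theta>\<^sub>3_pos q_gt_1 t_pos W_pos \<Lambda>_pos s E(3) m_pos
    by (intro nn_integral_Holder3 p_le h_le i_le) auto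
  finally show ?thesis .
qed


text \<open>The summands come from the scales below and above the splitting point. The factor 3
  bounds |z| on \<open>D\<close>, and division by \<open>m\<close> undoes the averaging over
  directions.\<close>

definition Cw :: real where
  "Cw = 3 / m * (m powr \<theta>\<^sub>1 * \<Lambda> powr \<theta>\<^sub>2 * m powr \<theta>\<^sub>3 / (1 - \<delta>) + \<Lambda> powr \<theta>\<^sub>2 * m powr \<theta>\<^sub>3 / (\<delta> + N / q - 1))"

lemma Cw_pos: "Cw > 0"
  using m_pos \<Lambda>_pos \<delta>_less_1 \<delta>_decay
  by (auto simp: Cw_def intro!: mult_pos_pos divide_pos_pos add_pos_pos)

text \<open>Positivity of \<open>e\<close> and \<open>P\<close> permits the normalisation in
  Hoelder's inequality and the final cancellation of a power of \<open>e\<close>;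
  \<open>weak_type\<close> removes both restrictions.\<close>

lemma weak_type_aux:
  fixes v :: "'a \<Rightarrow> real"
  assumes v: "C1c_with_grad \<Omega> v Dv"
    and e: "emeasure lborel {x. 1 \<le> \<bar>v x\<bar>} = ennreal e" "e > 0"
    and P: "(\<integral>\<^sup>+y. ennreal (norm (Dv y) powr q * \<rho> y) \<partial>lborel) \<le> ennreal P" "P > 0"
  shows "e powr (1 / qs) \<le> Cw * P powr (1 / q)"
proof -
  define E where "E = {x. 1 \<le> \<bar>v x\<bar>}"
  have E_sub: "E \<subseteq> \<Omega>" using C1c_compact_superlevel[OF v, of 1] by (simp add: E_def)
  have [measurable]: "E \<in> sets borel"
    using C1c_compact_superlevel[OF v, of 1] by (simp add: E_def borel_compact)
  have [measurable]: "Dv \<in> borel_measurable borel"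
    using C1c_with_gradD(2)[OF v] by (rule borel_measurable_continuous_onI)
  define F where "F s z x = ennreal (norm (Dv (x + s *\<^sub>R z))) * indicator E x * indicator D z" for s z x
  \<comment> \<open>The scale at which the two bounds of the slice integral coincide up to a constant\<close>
  define R where "R = e powr (1 / N)"
  have R: "R > 0" using e by (simp add: R_def)
  \<comment> \<open>\<open>k1\<close> and \<open>k2\<close> are the coefficients of the powers of
    \<open>s\<close> for the choices \<open>W = m * P\<close> and
    \<open>W = e * s powr (- N) * P\<close>.\<close>
  define k1 where "k1 = m powr \<theta>\<^sub>1 * \<Lambda> powr \<theta>\<^sub>2 * m powr \<theta>\<^sub>3 * P powr \<theta>\<^sub>1 * e powr (1 - \<theta>\<^sub>1)"
  define k2 where "k2 = \<Lambda> powr \<theta>\<^sub>2 * m powr \<theta>\<^sub>3 * P powr \<theta>\<^sub>1 * e"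
  have k: "k1 \<ge> 0" "k2 \<ge> 0" using e by (auto simp: k1_def k2_def)
  have slice: "(\<integral>\<^sup>+z. \<integral>\<^sup>+x. F s z x \<partial>lborel \<partial>lborel) \<le> ennreal (k1 * s powr (- \<delta>))"
    "(\<integral>\<^sup>+z. \<integral>\<^sup>+x. F s z x \<partial>lborel \<partial>lborel) \<le> ennreal (k2 * s powr (- \<delta> - N / q))" if s: "s > 0" for s
  proof -
    have *: "(\<integral>\<^sup>+z. \<integral>\<^sup>+x. F s z x \<partial>lborel \<partial>lborel)
        \<le> ennreal (W powr \<theta>\<^sub>1 * (\<Lambda> * s powr (\<gamma> - N) * e) powr \<theta>\<^sub>2 * (m * e) powr \<theta>\<^sub>3)"
      if "W = m * P \<or> W = e * s powr (- N) * P" for W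
      unfolding F_def using e P s that E_sub C1c_grad_eq_0[OF v]
      by (intro nn_integral_slice_le) (auto simp flip: E_def)
    have pw: "(s powr (\<gamma> - N)) powr \<theta>\<^sub>2 = s powr (- \<delta>)"
      by (simp add: powr_powr \<delta>_def minus_divide_left)
    have ee: "e powr \<theta>\<^sub>2 * e powr \<theta>\<^sub>3 = e powr (1 - \<theta>\<^sub>1)" "e powr \<theta>\<^sub>1 * e powr (1 - \<theta>\<^sub>1) = e"
      using e by (simp_all flip: powr_add)
    have "(m * P) powr \<theta>\<^sub>1 * (\<Lambda> * s powr (\<gamma> - N) * e) powr \<theta>\<^sub>2 * (m * e) powr \<theta>\<^sub>3
      = m powr \<theta>\<^sub>1 * \<Lambda> powr \<theta>\<^sub>2 * m powr \<theta>\<^sub>3 * P powr \<theta>\<^sub>1 * (e powr \<theta>\<^sub>2 * e powr \<theta>\<^sub>3) * (s powr (\<gamma> - N)) powr \<theta>\<^sub>2"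
      using m_pos \<Lambda>_pos P e by (simp add: powr_mult)
    then show "(\<integral>\<^sup>+z. \<integral>\<^sup>+x. F s z x \<partial>lborel \<partial>lborel) \<le> ennreal (k1 * s powr (- \<delta>))"
      using *[of "m * P"] unfolding ee pw by (simp add: k1_def)
    have "(e * s powr (- N) * P) powr \<theta>\<^sub>1 * (\<Lambda> * s powr (\<gamma> - N) * e) powr \<theta>\<^sub>2 * (m * e) powr \<theta>\<^sub>3
      = \<Lambda> powr \<theta>\<^sub>2 * m powr \<theta>\<^sub>3 * P powr \<theta>\<^sub>1 * (e powr \<theta>\<^sub>1 * (e powr \<theta>\<^sub>2 * e powr \<theta>\<^sub>3)) * ((s powr (\<gamma> - N)) powr \<theta>\<^sub>2 * (s powr (- N)) powr \<theta>\<^sub>1)"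
      using m_pos \<Lambda>_pos P e by (simp add: powr_mult)
    also have "(s powr (\<gamma> - N)) powr \<theta>\<^sub>2 * (s powr (- N)) powr \<theta>\<^sub>1 = s powr (- \<delta> - N / q)"
      unfolding pw using s by (simp add: powr_powr flip: powr_add)
    finally show "(\<integral>\<^sup>+z. \<integral>\<^sup>+x. F s z x \<partial>lborel \<partial>lborel) \<le> ennreal (k2 * s powr (- \<delta> - N / q))"
      using *[of "e * s powr (- N) * P"] unfolding ee by (simp add: k2_def)
  qed
  \<comment> \<open>Each pair in \<open>E\<close> times \<open>D\<close> contributes 1, which is at
    most \<open>\<bar>v x\<bar>\<close> and hence at most an integral along the ray.\<close>
  have "ennreal (m * e) = (\<integral>\<^sup>+z. \<integral>\<^sup>+x. indicator E x * indicator D z \<partial>lborel \<partial>lborel)"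
    using e m_pos by (simp add: nn_integral_multc nn_integral_cmult emeasure_D mult.commute E_def[symmetric] flip: ennreal_mult)
  also have "\<dots> \<le> (\<integral>\<^sup>+z. \<integral>\<^sup>+x. \<integral>\<^sup>+s. ennreal 3 * (F s z x * indicator {0..} s) \<partial>lborel \<partial>lborel \<partial>lborel)"
  proof (intro nn_integral_mono)
    fix z x :: 'a
    show "indicator E x * indicator D z \<le> (\<integral>\<^sup>+s. ennreal 3 * (F s z x * indicator {0..} s) \<partial>lborel)"
    proof (cases "x \<in> E \<and> z \<in> D")
      case True
      then have z: "norm z < 3" "z \<noteq> 0" using norm_D[of z] by auto
      have "1 \<le> ennreal \<bar>v x\<bar>" using True by (simp add: E_def)
      also have "\<dots> \<le> (\<integral>\<^sup>+s. ennreal (norm (Dv (x + s *\<^sub>R z)) * norm z) * indicator {0..} s \<partial>lborel)"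
        by (rule abs_le_nn_integral_ray[OF v z(2)])
      also have "\<dots> \<le> (\<integral>\<^sup>+s. ennreal 3 * (F s z x * indicator {0..} s) \<partial>lborel)"
      proof (intro nn_integral_mono)
        fix s :: real
        have "norm (Dv (x + s *\<^sub>R z)) * norm z \<le> 3 * norm (Dv (x + s *\<^sub>R z))"
          using z mult_left_mono[of "norm z" 3 "norm (Dv (x + s *\<^sub>R z))"] by (simp add: mult.commute)
        then have "ennreal (norm (Dv (x + s *\<^sub>R z)) * norm z) \<le> ennreal 3 * ennreal (norm (Dv (x + s *\<^sub>R z)))"
          by (subst ennreal_mult[symmetric]) (auto intro: ennreal_leI)
        then show "ennreal (norm (Dv (x + s *\<^sub>R z)) * norm z) * indicator {0..} s \<le> ennreal 3 * (F s z x * indicator {0..} s)"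
          using True by (auto simp: F_def split: split_indicator)
      qed
      finally show ?thesis using True by simp
    qed auto
  qed
  \<comment> \<open>Two applications of Tonelli's theorem bring \<open>s\<close> outermost, so that
    the slice bounds apply.\<close>
  also have "\<dots> = (\<integral>\<^sup>+z. \<integral>\<^sup>+s. \<integral>\<^sup>+x. ennreal 3 * (F s z x * indicator {0..} s) \<partial>lborel \<partial>lborel \<partial>lborel)"
    unfolding F_def by (intro nn_integral_cong lborel_pair.Fubini') measurable
  also have "\<dots> = (\<integral>\<^sup>+s. \<integral>\<^sup>+z. \<integral>\<^sup>+x. ennreal 3 * (F s z x * indicator {0..} s) \<partial>lborel \<partial>lborel \<partial>lborel)"
    unfolding F_def by (intro lborel_pair.Fubini') measurable
  also have "\<dots> = ennreal 3 * (\<integral>\<^sup>+s. (\<integral>\<^sup>+z. \<integral>\<^sup>+x. F s z x \<partial>lborel \<partial>lborel) * indicator {0..} s \<partial>lborel)"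
    unfolding F_def by (simp add: nn_integral_cmult nn_integral_multc)
  also have "(\<integral>\<^sup>+s. (\<integral>\<^sup>+z. \<integral>\<^sup>+x. F s z x \<partial>lborel \<partial>lborel) * indicator {0..} s \<partial>lborel)
      \<le> (\<integral>\<^sup>+s. ennreal k1 * (ennreal (s powr (- \<delta>)) * indicator {0..R} s) +
             ennreal k2 * (ennreal (s powr (- \<delta> - N / q)) * indicator {R..} s) \<partial>lborel)"
  proof (rule nn_integral_mono_AE)
    \<comment> \<open>The slice bounds hold for positive \<open>s\<close> only, so the null set {0}
      is removed.\<close>
    have "AE s in lborel. s \<noteq> (0::real)" by (rule AE_lborel_singleton)
    then show "AE s in lborel. (\<integral>\<^sup>+z. \<integral>\<^sup>+x. F s z x \<partial>lborel \<partial>lborel) * indicator {0..} s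
      \<le> ennreal k1 * (ennreal (s powr (- \<delta>)) * indicator {0..R} s) +
             ennreal k2 * (ennreal (s powr (- \<delta> - N / q)) * indicator {R..} s)"
    proof eventually_elim
      case (elim s)
      show ?case
      proof (cases "s < 0 \<or> R < s")
        case True
        then show ?thesis using slice(2)[of s] R k by (auto simp: ennreal_mult' split: split_indicator)
      next
        case False
        then have "(\<integral>\<^sup>+z. \<integral>\<^sup>+x. F s z x \<partial>lborel \<partial>lborel) \<le> ennreal k1 * (ennreal (s powr (- \<delta>)) * indicator {0..R} s)"
          using slice(1)[of s] elim k by (auto simp: ennreal_mult' split: split_indicator)
        then show ?thesis using False elim by (auto simp: add_increasing2)
      qed
    qed
  qed
  also have "\<dots> = ennreal k1 * ennreal (R powr (1 - \<delta>) / (1 - \<delta>)) +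
         ennreal k2 * ennreal (R powr (1 - \<delta> - N / q) / (\<delta> + N / q - 1))"
  proof -
    have "- (R powr (- \<delta> - N / q + 1)) / (- \<delta> - N / q + 1) = R powr (1 - \<delta> - N / q) / (\<delta> + N / q - 1)"
    proof -
      have "- \<delta> - N / q + 1 = - (\<delta> + N / q - 1)" "1 - \<delta> - N / q = - (\<delta> + N / q - 1)" by simp_all
      then show ?thesis by (simp only: minus_divide_divide)
    qed
    then show ?thesis
      using \<delta>_less_1 \<delta>_decay R nn_integral_powr_from_0[of "- \<delta>" R] nn_integral_powr_to_inf[of "- \<delta> - N / q" R]
      by (simp add: nn_integral_add nn_integral_cmult)
  qed
  also have "\<dots> = ennreal (k1 * (R powr (1 - \<delta>) / (1 - \<delta>)) + k2 * (R powr (1 - \<delta> - N / q) / (\<delta> + N / q - 1)))"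
  proof -
    have "0 \<le> R powr (1 - \<delta>) / (1 - \<delta>)" "0 \<le> R powr (1 - \<delta> - N / q) / (\<delta> + N / q - 1)"
      using \<delta>_less_1 \<delta>_decay by simp_all
    then show ?thesis using k by (simp add: ennreal_mult ennreal_plus del: times_divide_eq_right)
  qed
  \<comment> \<open>With \<open>R = e powr (1 / N)\<close> both terms carry the same power of
    \<open>e\<close>, since 1 - 1/qs = 1 - 1/q + (1 - \<delta>)/N.\<close>
  also have "k1 * (R powr (1 - \<delta>) / (1 - \<delta>)) + k2 * (R powr (1 - \<delta> - N / q) / (\<delta> + N / q - 1))
      = m / 3 * Cw * P powr \<theta>\<^sub>1 * e powr (1 - 1 / qs)"
  proof -
    have 1: "e powr (1 - \<theta>\<^sub>1) * R powr (1 - \<delta>) = e powr (1 - 1 / qs)"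
    proof -
      have "e powr (1 - \<theta>\<^sub>1) * R powr (1 - \<delta>) = e powr (1 - \<theta>\<^sub>1 + 1 / N * (1 - \<delta>))"
        by (simp only: R_def powr_powr powr_add)
      also have "1 - \<theta>\<^sub>1 + 1 / N * (1 - \<delta>) = 1 - 1 / qs"
        using N_pos by (simp add: inverse_qs field_simps)
      finally show ?thesis .
    qed
    have 2: "e * R powr (1 - \<delta> - N / q) = e powr (1 - 1 / qs)"
    proof -
      have "e * R powr (1 - \<delta> - N / q) = e powr (1 + 1 / N * (1 - \<delta> - N / q))"
        using e by (simp only: R_def powr_powr powr_add powr_one)
      also have "1 + 1 / N * (1 - \<delta> - N / q) = 1 - 1 / qs"
        using N_pos q_gt_1 by (simp add: inverse_qs field_simps)
      finally show ?thesis .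
    qed
    have k1: "k1 * (R powr (1 - \<delta>) / (1 - \<delta>)) = m powr \<theta>\<^sub>1 * \<Lambda> powr \<theta>\<^sub>2 * m powr \<theta>\<^sub>3 * P powr \<theta>\<^sub>1 * e powr (1 - 1 / qs) / (1 - \<delta>)"
      by (simp add: k1_def 1[symmetric] mult_ac)
    have k2: "k2 * (R powr (1 - \<delta> - N / q) / (\<delta> + N / q - 1)) = \<Lambda> powr \<theta>\<^sub>2 * m powr \<theta>\<^sub>3 * P powr \<theta>\<^sub>1 * e powr (1 - 1 / qs) / (\<delta> + N / q - 1)"
      by (simp add: k2_def 2[symmetric] mult_ac)
    have Cw: "m / 3 * Cw = m powr \<theta>\<^sub>1 * \<Lambda> powr \<theta>\<^sub>2 * m powr \<theta>\<^sub>3 / (1 - \<delta>) + \<Lambda> powr \<theta>\<^sub>2 * m powr \<theta>\<^sub>3 / (\<delta> + N / q - 1)"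
    proof -
      have "m / 3 * (3 / m * X) = X" for X :: real using m_pos by simp
      then show ?thesis unfolding Cw_def .
    qed
    show ?thesis unfolding k1 k2 Cw by (simp only: distrib_right times_divide_eq_left)
  qed
  finally have "ennreal (m * e) \<le> ennreal 3 * ennreal (m / 3 * Cw * P powr \<theta>\<^sub>1 * e powr (1 - 1 / qs))"
    by (simp add: mult_left_mono)
  then have "ennreal (m * e) \<le> ennreal (3 * (m / 3 * Cw * P powr \<theta>\<^sub>1 * e powr (1 - 1 / qs)))"
    by (subst ennreal_mult'[of 3]) simp_all
  then have "m * e \<le> m * (Cw * P powr \<theta>\<^sub>1 * e powr (1 - 1 / qs))"
    using Cw_pos m_pos by (subst (asm) ennreal_le_iff) (auto simp: mult_ac)
  then have "e \<le> Cw * P powr \<theta>\<^sub>1 * e powr (1 - 1 / qs)" using m_pos by simp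
  \<comment> \<open>Cancelling the positive factor \<open>e powr (1 - 1 / qs)\<close> leaves the
    claim.\<close>
  moreover have "e = e powr (1 / qs) * e powr (1 - 1 / qs)" using e by (simp flip: powr_add)
  ultimately show ?thesis using e by (metis mult_le_cancel_right powr_gt_zero not_less_iff_gr_or_eq)
qed

lemma weak_type:
  fixes v :: "'a \<Rightarrow> real"
  assumes v: "C1c_with_grad \<Omega> v Dv"
    and P: "(\<integral>\<^sup>+y. ennreal (norm (Dv y) powr q * \<rho> y) \<partial>lborel) \<le> ennreal P" "P \<ge> 0"
  shows "emeasure lborel {x. 1 \<le> \<bar>v x\<bar>} \<le> ennreal (Cw powr qs * P powr (qs / q))"
proof -
  define e where "e = measure lborel {x. 1 \<le> \<bar>v x\<bar>}"
  have e: "emeasure lborel {x. 1 \<le> \<bar>v x\<bar>} = ennreal e"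
    unfolding e_def
    using emeasure_bounded_finite[OF compact_imp_bounded[OF C1c_compact_superlevel(1)[OF v, of 1]]]
    by (intro emeasure_eq_ennreal_measure) simp
  show ?thesis
  proof (cases "e > 0")
    case True
    have *: "e powr (1 / qs) \<le> Cw * Q powr (1 / q)" if "Q \<ge> P" "Q > 0" for Q
      using that P by (intro weak_type_aux[OF v e True]) (auto intro: order_trans ennreal_leI)
    have "P > 0"
    proof (rule ccontr)
      assume "\<not> P > 0"
      \<comment> \<open>For this positive \<open>Q\<close> the right side of \<open>*\<close> is
        half of the left side. As \<open>P\<close> would be 0, \<open>Q\<close> is admissible, which
        is absurd.\<close>
      define Q where "Q = (e powr (1 / qs) / (2 * Cw)) powr q"
      have "Q > 0" using True Cw_pos by (simp add: Q_def)
      moreover have "Cw * Q powr (1 / q) = e powr (1 / qs) / 2"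
        using True Cw_pos q_gt_1 by (simp add: Q_def powr_powr)
      moreover have "e powr (1 / qs) > 0" using True by simp
      ultimately show False using *[of Q] P(2) \<open>\<not> P > 0\<close> by linarith
    qed
    then have "e powr (1 / qs) \<le> Cw * P powr (1 / q)" using *[of P] by simp
    then have "(e powr (1 / qs)) powr qs \<le> (Cw * P powr (1 / q)) powr qs"
      using qs_pos by (intro powr_mono2) auto
    also have "(e powr (1 / qs)) powr qs = e" using True qs_pos by (simp add: powr_powr)
    also have "(Cw * P powr (1 / q)) powr qs = Cw powr qs * P powr (qs / q)"
      using Cw_pos by (simp add: powr_mult powr_powr)
    finally show ?thesis by (simp add: e ennreal_leI)
  qed (simp add: e ennreal_neg)
qed

end

section \<open>The strong-type inequality\<close>

context kernel_weight
begin

lemma strong_type: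
  fixes u :: "'a \<Rightarrow> real"
  assumes u: "C1c_with_grad \<Omega> u Du"
    and G: "(\<integral>\<^sup>+y. ennreal (norm (Du y) powr q * \<rho> y) \<partial>lborel) = ennreal G" "G \<ge> 0"
  shows "(\<integral>\<^sup>+x. ennreal (\<bar>u x\<bar> powr qs) \<partial>lborel) \<le> ennreal ((12 * Cw) powr qs * G powr (qs / q))"
proof -
  have [measurable]: "u \<in> borel_measurable borel" "Du \<in> borel_measurable borel"
    using C1c_with_gradD(2,3)[OF u] by (auto intro: borel_measurable_continuous_onI)
  define f where "f y = ennreal (norm (Du y) powr q * \<rho> y)" for y
  have [measurable]: "f \<in> borel_measurable borel" unfolding f_def by measurable
  \<comment> \<open>Levels are dyadic in the square of \<open>u\<close>. \<open>A k\<close> lies one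
    step above \<open>B k\<close>: the truncation at level \<open>k\<close> equals 1 on
    \<open>A k\<close>, while its gradient lives on \<open>B k\<close>.\<close>
  define A where "A k = {x. 2 powr (of_int k + 1) \<le> (u x)\<^sup>2 \<and> (u x)\<^sup>2 < 2 powr (of_int k + 2)}" for k :: int
  define B where "B k = {x. 2 powr (of_int k) \<le> (u x)\<^sup>2 \<and> (u x)\<^sup>2 < 2 powr (of_int k + 1)}" for k :: int
  have [measurable]: "A k \<in> sets borel" "B k \<in> sets borel" for k
    unfolding A_def B_def by measurable
  \<comment> \<open>The level is recovered as a floor of a logarithm, with \<open>c = 1\<close> for
    \<open>A\<close> and \<open>c = 0\<close> for \<open>B\<close>; hence each family is
    disjoint.\<close>
  have level: "k = \<lfloor>log 2 ((u x)\<^sup>2) - c\<rfloor>"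
    if "2 powr (of_int k + c) \<le> (u x)\<^sup>2" "(u x)\<^sup>2 < 2 powr (of_int k + c + 1)" for k :: int and c x
  proof -
    have "(u x)\<^sup>2 > 0" using that(1) powr_gt_zero[of 2 "of_int k + c"] by linarith
    then have "of_int k + c \<le> log 2 ((u x)\<^sup>2)" "log 2 ((u x)\<^sup>2) < of_int k + c + 1"
      using that by (simp_all add: le_log_iff log_less_iff)
    then show ?thesis by linarith
  qed
  have A_disj: "k = l" if "x \<in> A k" "x \<in> A l" for x k l
    using that level[of k 1 x] level[of l 1 x] by (simp add: A_def add_ac)
  have B_disj: "k = l" if "x \<in> B k" "x \<in> B l" for x k l
    using that level[of k 0 x] level[of l 0 x] by (simp add: B_def)
  have A_cover: "x \<in> (\<Union>k. A k)" if "u x \<noteq> 0" for x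
  proof -
    define k where "k = \<lfloor>log 2 ((u x)\<^sup>2) - 1\<rfloor>"
    have "of_int k + 1 \<le> log 2 ((u x)\<^sup>2)" "log 2 ((u x)\<^sup>2) < of_int k + 2"
      unfolding k_def by linarith+
    then have "x \<in> A k"
      using that by (simp add: A_def le_log_iff log_less_iff)
    then show ?thesis by blast
  qed
  define c where "c = (12 * Cw) powr qs * G powr (qs / q - 1)"
  have level_le: "(\<integral>\<^sup>+x. ennreal (\<bar>u x\<bar> powr qs) * indicator (A k) x \<partial>lborel)
      \<le> ennreal c * (\<integral>\<^sup>+x. f x * indicator (B k) x \<partial>lborel)" for k
  proof -
    define a :: real where "a = 2 powr (of_int k)"
    \<comment> \<open>\<open>r\<close> is the reciprocal square root of \<open>a\<close>, so
      \<open>1 / r\<close> is the level measured in \<open>\<bar>u\<bar>\<close>.\<close>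
    define r :: real where "r = 2 powr (- of_int k / 2)"
    have a: "a > 0" and r: "r > 0" by (simp_all add: a_def r_def)
    have "r\<^sup>2 * a = 1"
      by (simp add: a_def r_def power2_eq_square flip: powr_add)
    define v where "v x = step_fun ((u x)\<^sup>2 / a)" for x
    define Dv where "Dv x = (step_deriv ((u x)\<^sup>2 / a) * (2 * u x / a)) *\<^sub>R Du x" for x
    have v: "C1c_with_grad \<Omega> v Dv"
      using C1c_with_grad_truncation[OF u a] by (simp add: v_def[abs_def] Dv_def[abs_def])
    have fB: "(\<integral>\<^sup>+x. f x * indicator (B k) x \<partial>lborel) \<le> ennreal G"
      unfolding G(1)[symmetric] f_def by (intro nn_integral_mono) (auto split: split_indicator)
    then obtain g where g: "(\<integral>\<^sup>+x. f x * indicator (B k) x \<partial>lborel) = ennreal g" "0 \<le> g" "g \<le> G"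
      using G(2) by (cases "\<integral>\<^sup>+x. f x * indicator (B k) x \<partial>lborel") (auto simp: top_unique)
    have norm_Dv: "norm (Dv x) \<le> 6 * r * norm (Du x)" "x \<notin> B k \<Longrightarrow> Dv x = 0" for x
    proof -
      show 0: "Dv x = 0" if "x \<notin> B k"
      proof -
        have "(u x)\<^sup>2 < a \<or> 2 * a \<le> (u x)\<^sup>2"
          using that by (auto simp: B_def a_def powr_add)
        then have "(u x)\<^sup>2 / a < 1 \<or> 2 \<le> (u x)\<^sup>2 / a" using a by (simp add: field_simps)
        then show ?thesis by (simp add: Dv_def step_deriv_bounds(2))
      qed
      show "norm (Dv x) \<le> 6 * r * norm (Du x)"
      proof (cases "x \<in> B k")
        case True
        then have "(u x)\<^sup>2 \<le> 2 * a" by (simp add: B_def a_def powr_add)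
        \<comment> \<open>The exact bound is sqrt 2 times \<open>r\<close>; 3/2 is a rational upper
          bound. With the factor 2 from differentiating the square and the bound 2 on
          \<open>step_deriv\<close>, it yields \<open>6 * r\<close>.\<close>
        have "(\<bar>u x\<bar> / a)\<^sup>2 \<le> (3 / 2 * r)\<^sup>2"
        proof -
          have "r\<^sup>2 = 1 / a" using \<open>r\<^sup>2 * a = 1\<close> a by (simp add: field_simps)
          moreover have "(u x)\<^sup>2 / a\<^sup>2 \<le> 2 * a / a\<^sup>2" using \<open>(u x)\<^sup>2 \<le> 2 * a\<close> by (intro divide_right_mono) auto
          moreover have "2 * a / a\<^sup>2 = 2 * (1 / a)" "1 / a > 0" using a by (auto simp: power2_eq_square)
          moreover have "(\<bar>u x\<bar> / a)\<^sup>2 = (u x)\<^sup>2 / a\<^sup>2" "(3 / 2 * r)\<^sup>2 = 9 / 4 * r\<^sup>2"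
            by (simp_all add: power_mult_distrib power_divide)
          ultimately show ?thesis by linarith
        qed
        then have "\<bar>u x\<bar> / a \<le> 3 / 2 * r" by (rule power2_le_imp_le) (use r in simp)
        then have "\<bar>step_deriv ((u x)\<^sup>2 / a)\<bar> * (2 * (\<bar>u x\<bar> / a)) \<le> 2 * (2 * (3 / 2 * r))"
          using a by (intro mult_mono[OF step_deriv_bounds(1)] mult_left_mono) simp_all
        then have "\<bar>step_deriv ((u x)\<^sup>2 / a) * (2 * u x / a)\<bar> \<le> 6 * r"
          using a by (simp add: abs_mult)
        then show ?thesis unfolding Dv_def norm_scaleR by (rule mult_right_mono) simp
      qed (use 0 r in simp)
    qed
    have "(\<integral>\<^sup>+y. ennreal (norm (Dv y) powr q * \<rho> y) \<partial>lborel)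
        \<le> (\<integral>\<^sup>+y. ennreal ((6 * r) powr q) * (f y * indicator (B k) y) \<partial>lborel)"
    proof (intro nn_integral_mono)
      fix y
      have "norm (Dv y) powr q * \<rho> y \<le> (6 * r) powr q * (norm (Du y) powr q * \<rho> y)"
      proof -
        have "norm (Dv y) powr q \<le> (6 * r * norm (Du y)) powr q"
          using norm_Dv(1) q_gt_1 by (intro powr_mono2) auto
        then show ?thesis using r \<rho>_pos[of y] by (simp add: powr_mult)
      qed
      then show "ennreal (norm (Dv y) powr q * \<rho> y) \<le> ennreal ((6 * r) powr q) * (f y * indicator (B k) y)"
        using norm_Dv(2)[of y] \<rho>_pos[of y]
        by (cases "y \<in> B k") (auto simp: f_def ennreal_leI simp flip: ennreal_mult)
    qed
    also have "\<dots> = ennreal ((6 * r) powr q * g)"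
      using g by (simp add: nn_integral_cmult ennreal_mult)
    finally have "emeasure lborel {x. 1 \<le> \<bar>v x\<bar>} \<le> ennreal (Cw powr qs * ((6 * r) powr q * g) powr (qs / q))"
      using g by (intro weak_type[OF v]) auto
    also have "Cw powr qs * ((6 * r) powr q * g) powr (qs / q) = (6 * r * Cw) powr qs * g powr (qs / q)"
      using g r Cw_pos q_gt_1 by (simp add: powr_mult powr_powr)
    finally have weak: "emeasure lborel {x. 1 \<le> \<bar>v x\<bar>} \<le> ennreal ((6 * r * Cw) powr qs * g powr (qs / q))" .
    have "(\<integral>\<^sup>+x. ennreal (\<bar>u x\<bar> powr qs) * indicator (A k) x \<partial>lborel)
        \<le> (\<integral>\<^sup>+x. ennreal ((2 / r) powr qs) * indicator (A k) x \<partial>lborel)"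
    proof (intro nn_integral_mono)
      fix x
      show "ennreal (\<bar>u x\<bar> powr qs) * indicator (A k) x \<le> ennreal ((2 / r) powr qs) * indicator (A k) x"
      proof (cases "x \<in> A k")
        case True
        then have "(u x)\<^sup>2 \<le> 4 * a" by (simp add: A_def a_def powr_add)
        also have "4 * a = (2 / r)\<^sup>2" using \<open>r\<^sup>2 * a = 1\<close> r by (simp add: power_divide field_simps)
        finally have "\<bar>u x\<bar> \<le> 2 / r" using r by (intro power2_le_imp_le[of "\<bar>u x\<bar>" "2 / r"]) simp_all
        then have "\<bar>u x\<bar> powr qs \<le> (2 / r) powr qs" using qs_pos by (intro powr_mono2) auto
        then show ?thesis by (simp add: ennreal_leI True)
      qed simp
    qed
    also have "\<dots> = ennreal ((2 / r) powr qs) * emeasure lborel (A k)"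
      by (simp add: nn_integral_cmult)
    also have "\<dots> \<le> ennreal ((2 / r) powr qs) * emeasure lborel {x. 1 \<le> \<bar>v x\<bar>}"
    proof (intro mult_left_mono emeasure_mono)
      show "A k \<subseteq> {x. 1 \<le> \<bar>v x\<bar>}"
        using a by (auto simp: A_def v_def a_def powr_add step_fun_eq le_divide_eq mult.commute)
      show "{x. 1 \<le> \<bar>v x\<bar>} \<in> sets lborel"
        using C1c_compact_superlevel(1)[OF v, of 1] by (simp add: borel_compact)
    qed simp
    also have "\<dots> \<le> ennreal ((2 / r) powr qs) * ennreal ((6 * r * Cw) powr qs * g powr (qs / q))"
      by (intro mult_left_mono weak) simp
    also have "\<dots> = ennreal ((12 * Cw) powr qs * g powr (qs / q))"
    proof -
      \<comment> \<open>The level parameter \<open>r\<close> cancels, so the constant is the same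
        for all \<open>k\<close>.\<close>
      have "(2 / r) powr qs * (6 * r * Cw) powr qs = (12 * Cw) powr qs"
        using r Cw_pos by (simp flip: powr_mult)
      then show ?thesis by (simp add: mult.assoc[symmetric] flip: ennreal_mult)
    qed
    also have "\<dots> \<le> ennreal (c * g)"
    proof (rule ennreal_leI)
      \<comment> \<open>One factor \<open>g\<close> is kept for the sum over levels; the remaining
        power is nonnegative because \<open>qs > q\<close>, so there \<open>g\<close> may be
        replaced by the total energy \<open>G\<close>.\<close>
      have "g powr (qs / q) = g * g powr (qs / q - 1)"
        using g powr_add[of g 1 "qs / q - 1"] by (cases "g = 0") auto
      also have "\<dots> \<le> g * G powr (qs / q - 1)"
        using g qs_gt_q q_gt_1 by (intro mult_left_mono powr_mono2) (auto simp: field_simps)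
      finally have "(12 * Cw) powr qs * g powr (qs / q) \<le> (12 * Cw) powr qs * (g * G powr (qs / q - 1))"
        by (rule mult_left_mono) simp
      then show "(12 * Cw) powr qs * g powr (qs / q) \<le> c * g"
        by (simp add: c_def mult_ac)
    qed
    also have "\<dots> = ennreal c * (\<integral>\<^sup>+x. f x * indicator (B k) x \<partial>lborel)"
      using g by (simp add: ennreal_mult c_def)
    finally show ?thesis .
  qed
  have "(\<integral>\<^sup>+x. ennreal (\<bar>u x\<bar> powr qs) \<partial>lborel) = (\<integral>\<^sup>+x. ennreal (\<bar>u x\<bar> powr qs) * indicator (\<Union>k. A k) x \<partial>lborel)"
    using A_cover by (intro nn_integral_cong) (auto split: split_indicator)
  also have "\<dots> = (\<integral>\<^sup>+k. \<integral>\<^sup>+x. ennreal (\<bar>u x\<bar> powr qs) * indicator (A k) x \<partial>lborel \<partial>count_space UNIV)"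
    by (subst nn_integral_count_space_indicator_disjoint) (auto intro: A_disj)
  also have "\<dots> \<le> (\<integral>\<^sup>+k. ennreal c * (\<integral>\<^sup>+x. f x * indicator (B k) x \<partial>lborel) \<partial>count_space UNIV)"
    by (intro nn_integral_mono level_le)
  also have "\<dots> = ennreal c * (\<integral>\<^sup>+x. f x * indicator (\<Union>k. B k) x \<partial>lborel)"
    by (subst nn_integral_cmult, simp, subst nn_integral_count_space_indicator_disjoint) (auto intro: B_disj)
  also have "\<dots> \<le> ennreal c * ennreal G"
    unfolding G(1)[symmetric] f_def
    by (intro mult_left_mono nn_integral_mono) (auto split: split_indicator)
  also have "\<dots> = ennreal ((12 * Cw) powr qs * (G powr (qs / q - 1) * G))"
    using G by (simp add: c_def mult.assoc flip: ennreal_mult)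
  also have "G powr (qs / q - 1) * G = G powr (qs / q)"
    using G powr_add[of G "qs / q - 1" 1] by (cases "G = 0") auto
  finally show ?thesis .
qed

end

section \<open>Passage to the closure\<close>

text \<open>Convexity of the power at the midpoint of \<open>a\<close> and \<open>b\<close>; if one
  of them is 0, it suffices that the constant is at least 1.\<close>

lemma powr_add_le_convex:
  fixes a b q :: real
  assumes "a \<ge> 0" "b \<ge> 0" "q \<ge> 1"
  shows "(a + b) powr q \<le> 2 powr (q - 1) * (a powr q + b powr q)"
proof (cases "a = 0 \<or> b = 0")
  case True
  moreover have "1 * (a powr q + b powr q) \<le> 2 powr (q - 1) * (a powr q + b powr q)"
    using assms by (intro mult_right_mono ge_one_powr_ge_zero) auto
  ultimately show ?thesis using assms by auto
next
  case False
  then have "((1 - 1/2) *\<^sub>R a + (1/2) *\<^sub>R b) powr q \<le> (1 - 1/2) * a powr q + 1/2 * b powr q"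
    using assms by (intro convex_onD[OF powr_convex]) auto
  then have "((a + b) / 2) powr q \<le> (a powr q + b powr q) / 2"
    by (simp add: field_simps)
  then have "(a + b) powr q / 2 powr q \<le> (a powr q + b powr q) / 2"
    using assms by (simp add: powr_divide)
  then have "(a + b) powr q \<le> 2 powr q * ((a powr q + b powr q) / 2)"
    by (simp add: field_simps)
  then show ?thesis by (simp add: powr_diff)
qed

text \<open>The powers of the differences tend to 0 in mean, so a subsequence of them tends to 0
  almost everywhere; taking roots gives convergence of the functions.\<close>

lemma AE_tendsto_subseq_if_tendsto_Lp:
  fixes f :: "nat \<Rightarrow> 'a \<Rightarrow> real"
  assumes [measurable]: "\<And>k. f k \<in> borel_measurable M" "u \<in> borel_measurable M" and q: "q > 0"
    and lim: "(\<lambda>k. \<integral>\<^sup>+x. ennreal (\<bar>f k x - u x\<bar> powr q) \<partial>M) \<longlonglongrightarrow> 0"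
  obtains r :: "nat \<Rightarrow> nat" where "strict_mono r" "AE x in M. (\<lambda>j. f (r j) x) \<longlonglongrightarrow> u x"
proof -
  define w where "w k x = \<bar>f k x - u x\<bar> powr q" for k x
  have [measurable]: "w k \<in> borel_measurable M" for k unfolding w_def by measurable
  have "\<forall>\<^sub>F k in sequentially. (\<integral>\<^sup>+x. ennreal (w k x) \<partial>M) < 1"
    using lim by (intro order_tendstoD(2)[of _ 0]) (auto simp: w_def)
  \<comment> \<open>Shifting the sequence by \<open>k0\<close> leaves only integrable terms.\<close>
  then obtain k0 where k0: "(\<integral>\<^sup>+x. ennreal (w k x) \<partial>M) < 1" if "k \<ge> k0" for k
    by (auto simp: eventually_sequentially)
  have int: "integrable M (w (k + k0))" for k
    using k0[of "k + k0"] by (intro integrableI_nonneg) (auto simp: w_def intro: order.strict_trans)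
  have "(\<lambda>k. enn2real (\<integral>\<^sup>+x. ennreal (w (k + k0) x) \<partial>M)) \<longlonglongrightarrow> enn2real 0"
    using LIMSEQ_ignore_initial_segment[OF lim, of k0]
    by (intro tendsto_enn2real) (auto simp: w_def)
  then have "(\<lambda>k. \<integral>x. norm (w (k + k0) x) \<partial>M) \<longlonglongrightarrow> 0"
    by (subst integral_eq_nn_integral) (auto simp: w_def)
  from tendsto_L1_AE_subseq[OF int this] obtain r :: "nat \<Rightarrow> nat"
    where r: "strict_mono r" "AE x in M. (\<lambda>j. w (r j + k0) x) \<longlonglongrightarrow> 0" by auto
  show ?thesis
  proof
    show "strict_mono (\<lambda>j. r j + k0)" using r(1) by (simp add: strict_mono_def)
    show "AE x in M. (\<lambda>j. f (r j + k0) x) \<longlonglongrightarrow> u x"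
      using r(2)
    proof eventually_elim
      case (elim x)
      have "(\<lambda>j. w (r j + k0) x powr (1 / q)) \<longlonglongrightarrow> 0 powr (1 / q)"
        using q by (intro tendsto_powr'[OF elim]) (auto simp: w_def)
      then have "(\<lambda>j. \<bar>f (r j + k0) x - u x\<bar>) \<longlonglongrightarrow> 0"
        using q by (simp add: w_def powr_powr)
      then show ?case by (simp add: tendsto_rabs_zero_iff LIM_zero_iff)
    qed
  qed
qed

theorem theorem6p1:
  fixes \<Omega> :: "'a::euclidean_space set" and \<rho> :: "'a \<Rightarrow> real"
    and t \<gamma> K q qs :: real
  assumes "open \<Omega>" and "bounded \<Omega>"
    and "t > 0" and "\<gamma> < real DIM('a)"
    and "\<rho> \<in> borel_measurable (lebesgue_on \<Omega>)"
    and "\<exists>M. AE x in lebesgue_on \<Omega>. \<bar>\<rho> x\<bar> \<le> M"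
    and "\<forall>x\<in>\<Omega>. \<rho> x \<ge> 0"
    and "K > 0"
    and "\<forall>x\<in>\<Omega>. (\<integral>\<^sup>+ y\<in>\<Omega>. kernel_integrand \<rho> t \<gamma> x y \<partial>lebesgue) \<le> ennreal K"
    and "q > (real DIM('a) - \<gamma>) / t"
    and "q > 1 + 1 / t"
    and "q < (real DIM('a) - \<gamma>) / t + real DIM('a)"
    and "1 / qs = (1 / q) * (1 + 1 / t - \<gamma> / (real DIM('a) * t)) - 1 / real DIM('a)"
  shows "\<exists>c>0.
     (\<forall>u Du. C1c_with_grad \<Omega> u Du \<longrightarrow>
        Lp_int qs \<Omega> u < \<infinity> \<and> Lp_norm qs \<Omega> u \<le> c * wgrad_norm q \<rho> \<Omega> Du) \<and>
     (\<forall>u G. (u, G) \<in> W10 \<Omega> \<rho> q \<longrightarrow>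
        Lp_int qs \<Omega> u < \<infinity> \<and> Lp_norm qs \<Omega> u \<le> c * wgrad_norm q \<rho> \<Omega> G)"
proof (cases "\<Omega> = {}")
  case True
  then show ?thesis
    by (intro exI[of _ 1]) (simp add: Lp_int_def Lp_norm_def wgrad_norm_def)
next
  case False

  \<comment> \<open>Positivity and regularisation of the weight\<close>
  have \<Omega>_lebesgue [measurable]: "\<Omega> \<in> sets lebesgue" and \<Omega>_borel [measurable]: "\<Omega> \<in> sets borel"
    using assms(1) by (auto simp: borel_open)
  have AE_\<Omega>: "(AE x in lebesgue_on \<Omega>. P x) \<longleftrightarrow> (AE x in lebesgue. x \<in> \<Omega> \<longrightarrow> P x)" for P
    by (subst AE_restrict_space_iff) auto
  define \<rho>0 where "\<rho>0 x = (if x \<in> \<Omega> then \<rho> x else 0)" for x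
  have \<rho>0 [measurable]: "\<rho>0 \<in> borel_measurable lebesgue"
    unfolding \<rho>0_def[abs_def] using assms(5) by (intro borel_measurable_if_I) auto
  \<comment> \<open>The kernel integrand is infinite where the weight vanishes, so finiteness of its
    integral for a single \<open>x\<close> already forces positivity almost everywhere in
    \<Omega>.\<close>
  have \<rho>_pos: "AE x in lebesgue. x \<in> \<Omega> \<longrightarrow> \<rho> x > 0"
  proof -
    obtain x where x: "x \<in> \<Omega>" using False by auto
    have "(\<lambda>y. norm (x - y) powr \<gamma>) \<in> borel_measurable lebesgue"
      by (intro measurable_completion) measurable
    then have "(\<lambda>y. \<rho>0 y powr t * norm (x - y) powr \<gamma>) \<in> borel_measurable lebesgue"
      by (rule borel_measurable_times[OF powr_real_measurable[OF \<rho>0 borel_measurable_const]])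
    moreover have "{y \<in> space lebesgue. \<rho>0 y = 0} \<in> sets lebesgue"
      using measurable_sets[OF \<rho>0, of "{0}"] by (simp add: vimage_def)
    ultimately have [measurable]: "(\<lambda>y. kernel_integrand \<rho>0 t \<gamma> x y) \<in> borel_measurable lebesgue"
      unfolding kernel_integrand_def 
      by (intro measurable_If borel_measurable_const measurable_compose[OF _ measurable_ennreal] borel_measurable_divide)
    have "(\<integral>\<^sup>+ y. kernel_integrand \<rho>0 t \<gamma> x y * indicator \<Omega> y \<partial>lebesgue) \<le> ennreal K"
    proof -
      have "(\<integral>\<^sup>+ y. kernel_integrand \<rho>0 t \<gamma> x y * indicator \<Omega> y \<partial>lebesgue)
          = (\<integral>\<^sup>+ y\<in>\<Omega>. kernel_integrand \<rho> t \<gamma> x y \<partial>lebesgue)"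
        by (intro nn_integral_cong) (simp add: kernel_integrand_def \<rho>0_def indicator_def)
      then show ?thesis using assms(9) x by simp
    qed
    then have "AE y in lebesgue. kernel_integrand \<rho>0 t \<gamma> x y * indicator \<Omega> y \<noteq> \<infinity>"
      by (intro nn_integral_PInf_AE) (auto simp: top_unique)
    then show ?thesis
    proof eventually_elim
      case (elim y)
      then show ?case using assms(7) by (auto simp: kernel_integrand_def \<rho>0_def le_less)
    qed
  qed
  \<comment> \<open>Changing the weight on a null set makes it Borel and positive everywhere, so that
    all product-space arguments can be carried out with Borel functions.\<close>
  obtain \<rho>1 where \<rho>1 [measurable]: "\<rho>1 \<in> borel_measurable borel" and \<rho>1_eq: "AE x in lebesgue. \<rho>0 x = \<rho>1 x"
    using completion_ex_borel_measurable_real[OF \<rho>0] AE_completion by auto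
  define \<rho>' where "\<rho>' x = (if \<rho>1 x > 0 then \<rho>1 x else 1)" for x
  have [measurable]: "\<rho>' \<in> borel_measurable borel" unfolding \<rho>'_def by measurable
  have \<rho>'_eq: "AE x in lebesgue. x \<in> \<Omega> \<longrightarrow> \<rho>' x = \<rho> x"
    using \<rho>1_eq \<rho>_pos by eventually_elim (auto simp: \<rho>'_def \<rho>0_def)
  define b :: 'a where "b = (SOME b. b \<in> Basis)"
  have b: "norm b = 1"
    using someI_ex[of "\<lambda>b::'a. b \<in> Basis"] nonempty_Basis unfolding b_def by auto
  interpret W: kernel_weight \<Omega> \<rho>' t \<gamma> K q "real DIM('a)" b
  proof
    fix x assume x: "x \<in> \<Omega>"
    have "(\<integral>\<^sup>+y. ennreal (1 / (\<rho>' y powr t * norm (x - y) powr \<gamma>)) * indicator \<Omega> y \<partial>lborel)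
      = (\<integral>\<^sup>+y. ennreal (1 / (\<rho>' y powr t * norm (x - y) powr \<gamma>)) * indicator \<Omega> y \<partial>lebesgue)"
      by (simp add: nn_integral_completion)
    also have "\<dots> = (\<integral>\<^sup>+ y\<in>\<Omega>. kernel_integrand \<rho> t \<gamma> x y \<partial>lebesgue)"
      by (rule nn_integral_cong_AE, use \<rho>'_eq \<rho>_pos in eventually_elim)
         (auto simp: kernel_integrand_def split: split_indicator)
    also have "\<dots> \<le> ennreal K" using assms(9) x by simp
    finally show "(\<integral>\<^sup>+y. ennreal (1 / (\<rho>' y powr t * norm (x - y) powr \<gamma>)) * indicator \<Omega> y \<partial>lborel) \<le> ennreal K" .
  qed (use assms b in \<open>auto simp: \<rho>'_def\<close>)

  \<comment> \<open>The inequality for continuously differentiable functions\<close>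
  have qs: "qs = W.qs"
  proof -
    have "1 / W.qs = (1 / q) * (1 + 1 / t - \<gamma> / (real DIM('a) * t)) - 1 / real DIM('a)"
      unfolding W.inverse_qs W.\<delta>_def using assms(3) W.q_gt_1 by (simp add: field_simps)
    then have "1 / qs = 1 / W.qs" using assms(13) by simp
    then show ?thesis by simp
  qed
  note qs_pos = W.qs_pos[folded qs]
  define C where "C = 12 * W.Cw"
  have C: "C > 0" using W.Cw_pos by (simp add: C_def)
  have C1c: "wgrad_int q \<rho> \<Omega> Du < \<infinity>"
    "Lp_int qs \<Omega> u \<le> ennreal (C powr qs * enn2real (wgrad_int q \<rho> \<Omega> Du) powr (qs / q))"
    if u: "C1c_with_grad \<Omega> u Du" for u Du
  proof -
    have eq: "wgrad_int q \<rho> \<Omega> Du = (\<integral>\<^sup>+y. ennreal (norm (Du y) powr q * \<rho>' y) \<partial>lborel)"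
    proof -
      have "wgrad_int q \<rho> \<Omega> Du = (\<integral>\<^sup>+y. ennreal (norm (Du y) powr q * \<rho>' y) \<partial>lebesgue)"
        unfolding wgrad_int_def
        by (rule nn_integral_cong_AE, use \<rho>'_eq in eventually_elim)
           (auto simp: C1c_grad_eq_0[OF u] split: split_indicator)
      then show ?thesis by (simp add: nn_integral_completion)
    qed
    show fin: "wgrad_int q \<rho> \<Omega> Du < \<infinity>"
    proof -
      \<comment> \<open>The weight, the gradient and the domain are all bounded, so the energy is
        finite and \<open>enn2real\<close> loses nothing.\<close>
      obtain M where M: "AE x in lebesgue. x \<in> \<Omega> \<longrightarrow> \<bar>\<rho> x\<bar> \<le> M"
        using assms(6) unfolding AE_\<Omega> by blast
      have "compact (Du ` closure \<Omega>)"
        using C1c_with_gradD(2)[OF u] assms(2)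
        by (intro compact_continuous_image) (auto intro: continuous_on_subset simp: compact_closure)
      then obtain L where L: "norm (Du x) \<le> L" if "x \<in> \<Omega>" for x
        using compact_imp_bounded closure_subset by (fastforce simp: bounded_iff)
      have "wgrad_int q \<rho> \<Omega> Du \<le> (\<integral>\<^sup>+y. ennreal (L powr q * M) * indicator \<Omega> y \<partial>lebesgue)"
        unfolding wgrad_int_def
      proof (rule nn_integral_mono_AE, use M in eventually_elim)
        case (elim y)
        show ?case
        proof (cases "y \<in> \<Omega>")
          case True
          then have "norm (Du y) powr q * \<rho> y \<le> L powr q * M"
            using elim L[of y] assms(7) W.q_gt_1 by (intro mult_mono powr_mono2) auto
          then show ?thesis by (simp add: ennreal_leI True)
        qed simp
      qed
      also have "\<dots> = ennreal (L powr q * M) * emeasure lebesgue \<Omega>"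
        by (simp add: nn_integral_cmult)
      also have "\<dots> < \<infinity>"
        using emeasure_bounded_finite[OF assms(2)] by (simp add: ennreal_mult_less_top)
      finally show ?thesis .
    qed
    have "Lp_int qs \<Omega> u \<le> (\<integral>\<^sup>+x. ennreal (\<bar>u x\<bar> powr qs) \<partial>lborel)"
      unfolding Lp_int_def
      by (subst nn_integral_completion) (auto intro!: nn_integral_mono split: split_indicator)
    also have "\<dots> \<le> ennreal (C powr qs * enn2real (wgrad_int q \<rho> \<Omega> Du) powr (qs / q))"
      unfolding qs C_def using fin by (intro W.strong_type[OF u]) (auto simp: eq)
    finally show "Lp_int qs \<Omega> u \<le> ennreal (C powr qs * enn2real (wgrad_int q \<rho> \<Omega> Du) powr (qs / q))" .
  qed
  \<comment> \<open>The extra factor, at least 1, pays for the convexity inequality used in the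
    limit; one constant then serves both claims.\<close>
  define c where "c = C * 2 powr ((q - 1) / q)"
  have "C \<le> c"
    using C W.q_gt_1 mult_left_mono[of 1 "2 powr ((q - 1) / q)" C] ge_one_powr_ge_zero[of 2 "(q - 1) / q"]
    by (simp add: c_def)
  have norm_le: "Lp_int qs \<Omega> u < \<infinity> \<and> Lp_norm qs \<Omega> u \<le> c * wgrad_norm q \<rho> \<Omega> G"
    if le: "Lp_int qs \<Omega> u \<le> ennreal (c powr qs * enn2real (wgrad_int q \<rho> \<Omega> G) powr (qs / q))" for u G
  proof
    show "Lp_int qs \<Omega> u < \<infinity>" using le by (rule order.strict_trans1) simp
    have "enn2real (Lp_int qs \<Omega> u) \<le> c powr qs * enn2real (wgrad_int q \<rho> \<Omega> G) powr (qs / q)"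
      using enn2real_mono[OF le] by simp
    then have "Lp_norm qs \<Omega> u \<le> (c powr qs * enn2real (wgrad_int q \<rho> \<Omega> G) powr (qs / q)) powr (1 / qs)"
      unfolding Lp_norm_def using qs_pos by (intro powr_mono2) auto
    also have "\<dots> = c * wgrad_norm q \<rho> \<Omega> G"
      using qs_pos C \<open>C \<le> c\<close> by (simp add: powr_mult powr_powr wgrad_norm_def)
    finally show "Lp_norm qs \<Omega> u \<le> c * wgrad_norm q \<rho> \<Omega> G" .
  qed
  have part1: "Lp_int qs \<Omega> u < \<infinity> \<and> Lp_norm qs \<Omega> u \<le> c * wgrad_norm q \<rho> \<Omega> Du"
    if u: "C1c_with_grad \<Omega> u Du" for u Du
  proof (rule norm_le)
    have "C powr qs \<le> c powr qs" using C \<open>C \<le> c\<close> qs_pos by (intro powr_mono2) auto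
    then show "Lp_int qs \<Omega> u \<le> ennreal (c powr qs * enn2real (wgrad_int q \<rho> \<Omega> Du) powr (qs / q))"
      using C1c(2)[OF u] by (elim order_trans) (intro ennreal_leI mult_right_mono, auto)
  qed

  \<comment> \<open>The inequality on the closure\<close>
  have part2: "Lp_int qs \<Omega> u < \<infinity> \<and> Lp_norm qs \<Omega> u \<le> c * wgrad_norm q \<rho> \<Omega> G"
    if uG: "(u, G) \<in> W10 \<Omega> \<rho> q" for u G
  proof (rule norm_le)
    let ?M = "lebesgue_on \<Omega>"
    have int_\<Omega>: "(\<integral>\<^sup>+x\<in>\<Omega>. f x \<partial>lebesgue) = (\<integral>\<^sup>+x. f x \<partial>?M)" for f
      by (subst nn_integral_restrict_space) auto
    have [measurable]: "u \<in> borel_measurable ?M" "G \<in> borel_measurable ?M" "\<rho> \<in> borel_measurable ?M"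
      using uG assms(5) by (auto simp: W10_def)
    obtain \<phi> D\<phi> where \<phi>: "\<And>k. C1c_with_grad \<Omega> (\<phi> k) (D\<phi> k)"
      and lim: "(\<lambda>k. \<integral>\<^sup>+x. ennreal (\<bar>\<phi> k x - u x\<bar> powr q) \<partial>?M) \<longlonglongrightarrow> 0"
      and limD: "(\<lambda>k. \<integral>\<^sup>+x. ennreal (norm (D\<phi> k x - G x) powr q * \<rho> x) \<partial>?M) \<longlonglongrightarrow> 0"
      using uG unfolding W10_def int_\<Omega> by blast
    have [measurable]: "\<phi> k \<in> borel_measurable ?M" "D\<phi> k \<in> borel_measurable ?M" for k
      using C1c_with_gradD(2,3)[OF \<phi>[of k]]
      by (auto intro!: measurable_restrict_space1 measurable_completion borel_measurable_continuous_onI)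
    obtain r where r: "strict_mono r" "AE x in ?M. (\<lambda>j. \<phi> (r j) x) \<longlonglongrightarrow> u x"
      using AE_tendsto_subseq_if_tendsto_Lp[OF _ _ _ lim] W.q_gt_1 by auto
    define \<epsilon> where "\<epsilon> k = (\<integral>\<^sup>+x. ennreal (norm (D\<phi> k x - G x) powr q * \<rho> x) \<partial>?M)" for k
    define g where "g = wgrad_int q \<rho> \<Omega> G"
    have g_fin: "g < \<infinity>" using uG by (simp add: W10_def g_def wgrad_int_def)
    have D\<phi>_le: "wgrad_int q \<rho> \<Omega> (D\<phi> k) \<le> ennreal (2 powr (q - 1)) * (\<epsilon> k + g)" for k
    proof -
      have "wgrad_int q \<rho> \<Omega> (D\<phi> k) \<le> (\<integral>\<^sup>+x. ennreal (2 powr (q - 1)) *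
          (ennreal (norm (D\<phi> k x - G x) powr q * \<rho> x) + ennreal (norm (G x) powr q * \<rho> x)) \<partial>?M)"
        unfolding wgrad_int_def int_\<Omega>
      proof (intro nn_integral_mono)
        fix x assume "x \<in> space ?M"
        then have \<rho>: "\<rho> x \<ge> 0" using assms(7) by (simp add: space_restrict_space)
        have "norm (D\<phi> k x) powr q \<le> (norm (D\<phi> k x - G x) + norm (G x)) powr q"
          using W.q_gt_1 norm_triangle_ineq[of "D\<phi> k x - G x" "G x"] by (intro powr_mono2) auto
        also have "\<dots> \<le> 2 powr (q - 1) * (norm (D\<phi> k x - G x) powr q + norm (G x) powr q)"
          using W.q_gt_1 by (intro powr_add_le_convex) auto
        finally have "norm (D\<phi> k x) powr q * \<rho> x \<le> 2 powr (q - 1) * (norm (D\<phi> k x - G x) powr q + norm (G x) powr q) * \<rho> x"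
          using \<rho> by (rule mult_right_mono)
        then show "ennreal (norm (D\<phi> k x) powr q * \<rho> x) \<le> ennreal (2 powr (q - 1)) *
          (ennreal (norm (D\<phi> k x - G x) powr q * \<rho> x) + ennreal (norm (G x) powr q * \<rho> x))"
          using \<rho> by (simp add: ennreal_leI algebra_simps flip: ennreal_mult ennreal_plus)
      qed
      also have "\<dots> = ennreal (2 powr (q - 1)) * (\<epsilon> k + g)"
        by (simp add: nn_integral_cmult nn_integral_add \<epsilon>_def g_def wgrad_int_def int_\<Omega>)
      finally show ?thesis .
    qed
    define s where "s k = C powr qs * (2 powr (q - 1) * enn2real (\<epsilon> k + g)) powr (qs / q)" for k
    have \<epsilon>g: "(\<lambda>k. \<epsilon> k + g) \<longlonglongrightarrow> g"
      using tendsto_add[OF limD tendsto_const[of g]] by (simp add: \<epsilon>_def)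
    \<comment> \<open>Since \<open>enn2real\<close> sends infinity to 0, finiteness of
      \<open>\<epsilon> k + g\<close> matters; for large \<open>k\<close> it follows from
      convergence to the finite \<open>g\<close>.\<close>
    have "\<forall>\<^sub>F k in sequentially. Lp_int qs \<Omega> (\<phi> k) \<le> ennreal (s k)"
      using order_tendstoD(2)[OF \<epsilon>g g_fin]
    proof eventually_elim
      case (elim k)
      have "enn2real (wgrad_int q \<rho> \<Omega> (D\<phi> k)) \<le> 2 powr (q - 1) * enn2real (\<epsilon> k + g)"
        using enn2real_mono[OF D\<phi>_le[of k]] elim by (simp add: enn2real_mult ennreal_mult_less_top)
      then have "C powr qs * enn2real (wgrad_int q \<rho> \<Omega> (D\<phi> k)) powr (qs / q) \<le> s k"
        unfolding s_def using qs_pos W.q_gt_1 by (intro mult_left_mono powr_mono2) auto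
      then show ?case using C1c(2)[OF \<phi>, of k] by (meson ennreal_leI order_trans)
    qed
    then have ev: "\<forall>\<^sub>F j in sequentially. Lp_int qs \<Omega> (\<phi> (r j)) \<le> ennreal (s (r j))"
      by (rule eventually_compose_filterlim[OF _ filterlim_subseq[OF r(1)]])
    have "s \<longlonglongrightarrow> C powr qs * (2 powr (q - 1) * enn2real g) powr (qs / q)"
    proof -
      have "(\<lambda>k. enn2real (\<epsilon> k + g)) \<longlonglongrightarrow> enn2real g"
        using g_fin \<epsilon>g by (intro tendsto_enn2real) simp_all
      then show ?thesis
        unfolding s_def using qs_pos W.q_gt_1
        by (intro tendsto_mult tendsto_const tendsto_powr') auto
    qed
    then have lim_s: "(\<lambda>j. ennreal (s (r j))) \<longlonglongrightarrow> ennreal (C powr qs * (2 powr (q - 1) * enn2real g) powr (qs / q))"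
      using LIMSEQ_subseq_LIMSEQ[OF _ r(1)] by (intro tendsto_ennrealI) (auto simp: o_def)
    \<comment> \<open>Almost everywhere convergence along \<open>r\<close> identifies the integrand
      with a lower limit, as Fatou's lemma requires.\<close>
    have "Lp_int qs \<Omega> u = (\<integral>\<^sup>+x. liminf (\<lambda>j. ennreal (\<bar>\<phi> (r j) x\<bar> powr qs)) \<partial>?M)"
      unfolding Lp_int_def int_\<Omega>
    proof (rule nn_integral_cong_AE, use r(2) in eventually_elim)
      case (elim x)
      have "(\<lambda>j. ennreal (\<bar>\<phi> (r j) x\<bar> powr qs)) \<longlonglongrightarrow> ennreal (\<bar>u x\<bar> powr qs)"
        using qs_pos by (intro tendsto_ennrealI tendsto_powr' tendsto_rabs elim tendsto_const) auto
      from lim_imp_Liminf[OF sequentially_bot this] show ?case by simp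
    qed
    also have "\<dots> \<le> liminf (\<lambda>j. Lp_int qs \<Omega> (\<phi> (r j)))"
      unfolding Lp_int_def int_\<Omega> by (intro nn_integral_liminf) measurable
    also have "\<dots> \<le> liminf (\<lambda>j. ennreal (s (r j)))"
      by (intro Liminf_mono ev)
    also have "\<dots> = ennreal (C powr qs * (2 powr (q - 1) * enn2real g) powr (qs / q))"
      by (rule lim_imp_Liminf[OF sequentially_bot lim_s])
    \<comment> \<open>The factor \<open>(2 powr (q - 1)) powr (qs / q)\<close> is the
      \<open>qs\<close>-th power of the extra factor in \<open>c\<close>.\<close>
    also have "C powr qs * (2 powr (q - 1) * enn2real g) powr (qs / q) = c powr qs * enn2real g powr (qs / q)"
      using C by (simp add: c_def powr_mult powr_powr)
    finally show "Lp_int qs \<Omega> u \<le> ennreal (c powr qs * enn2real (wgrad_int q \<rho> \<Omega> G) powr (qs / q))"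
      by (simp add: g_def)
  qed
  show ?thesis
    using part1 part2 C \<open>C \<le> c\<close> by (intro exI[of _ c]) auto
qed

end
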